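(* Let $(X_i)_{i=1}^\infty$ be independent with $X_i\sim\mathrm{Exp}(i)$ and $M=\sup_{i\ge1}X_i$. Then for every integer $k\ge1$, $$ \begin{aligned} E(M^k)=k!(-6)^k\Bigg(&\binom{2k-1}{k}-\frac{2\pi}{3\sqrt3}\binom{2k-2}{k-1} +\sum_{j=1}^{\lfloor k/2\rfloor}\frac{(-1)^j\pi^{2j}B_{2j}}{(2j)!}\big(2^{2j-1}-1\big)\Big(1-\frac{3}{3^{2j}}\Big)\binom{2k-2j-1}{k-1}\\ &-\frac{2}{\sqrt3}\sum_{j=1}^{\lfloor (k-1)/2\rfloor}\Big(\frac\pi3\Big)^{2j+1}(-1)^j\binom{2k-2j-2}{k-1}\left(\frac{3j+1}{(2j+1)!}-3\sum_{\ell=1}^{j}\frac{6^{2\ell-1}B_{2\ell}}{(2j-2\ell+1)!\,(2\ell)!}\right)\Bigg). \end{aligned} $$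
   Context: $\mathrm{Exp}(\lambda)$ denotes the exponential distribution with rate $\lambda$ (density $\lambda e^{-\lambda x}$, $x\ge0$). The Bernoulli numbers $B_n$ are defined by $\frac{z}{e^z-1}=\sum_{n\ge0}\frac{B_n}{n!}z^n$ for $|z|<2\pi$. Empty sums are zero. *)

theory Defs
  imports "HOL-Probability.Probability" "HOL-Computational_Algebra.Formal_Power_Series"
begin

definition bernoulli :: "nat \<Rightarrow> real" where
  "bernoulli n = fact n * fps_nth (fps_X div (fps_exp (1::real) - 1)) n"

end

theory Submission
  imports Defs "HOL-Complex_Analysis.Laurent_Convergence"
begin

text \<open>
  With \<open>q = e\<^bsup>-x\<^esup>\<close> one has \<open>P (M \<le> x) = \<Prod>\<^sub>i (1 - q\<^sup>i)\<close>, which Euler's pentagonal number theorem turns into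
  an alternating sum of exponentials in \<open>x\<close>.  Integrating \<open>k x\<^bsup>k-1\<^esup> P (M > x)\<close> termwise gives
  \<open>k! \<Sum>\<^sub>m (-1)\<^bsup>m+1\<^esup> 2\<^sup>k / (m (3m - 1))\<^sup>k\<close>, summed over all integers \<open>m \<noteq> 0\<close>.  Since
  \<open>-3m (3m - 1) = 3m (1 - 3m)\<close>, partial fractions reduce this to the sums of
  \<open>(-1)\<^sup>m ((3m)\<^bsup>-i\<^esup> + (1 - 3m)\<^bsup>-i\<^esup>)\<close>.  Their generating function is elementary by the partial fraction
  expansion of \<open>\<pi> / sin (\<pi> z)\<close>, and comparing coefficients with the power series of
  \<open>z cot z = B(2\<i>z) + \<i>z\<close>, where \<open>B(z) = z / (e\<^sup>z - 1)\<close>, produces the Bernoulli numbers.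
\<close>

subsection \<open>Symmetric summation over the integers\<close>

text \<open>The partial fraction series of the cotangent and the cosecant converge only in this sense.\<close>
definition eisenstein_sums :: "(int \<Rightarrow> 'a::real_normed_vector) \<Rightarrow> 'a \<Rightarrow> bool"  (infixr "esums" 80)
  where "f esums s \<longleftrightarrow> (\<lambda>N. \<Sum>m\<in>{- int N..int N}. f m) \<longlonglongrightarrow> s"

lemma sum_symmetric_int_atLeastAtMost:
  fixes f :: "int \<Rightarrow> 'a::comm_monoid_add"
  shows "(\<Sum>m\<in>{- int N..int N}. f m) = f 0 + (\<Sum>n<N. f (int (Suc n)) + f (- int (Suc n)))"
proof (induction N)
  case (Suc N)
  have "{- int (Suc N)..int (Suc N)} = insert (int (Suc N)) (insert (- int (Suc N)) {- int N..int N})"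
    by auto
  then have "(\<Sum>m\<in>{- int (Suc N)..int (Suc N)}. f m)
      = f (int (Suc N)) + (f (- int (Suc N)) + (\<Sum>m\<in>{- int N..int N}. f m))"
    by simp
  then show ?case
    by (simp add: Suc ac_simps)
qed simp

lemma esums_iff: "f esums s \<longleftrightarrow> (\<lambda>n. f (int (Suc n)) + f (- int (Suc n))) sums (s - f 0)"
  using tendsto_add_const_iff[of "f 0" "\<lambda>N. \<Sum>n<N. f (int (Suc n)) + f (- int (Suc n))" "s - f 0"]
  by (simp add: eisenstein_sums_def sums_def sum_symmetric_int_atLeastAtMost)

lemma esums_imp_suminf_add_suminf:
  assumes "f esums s" "summable (\<lambda>n. f (int (Suc n)))" "summable (\<lambda>n. f (- int (Suc n)))"
  shows "(\<Sum>n. f (int (Suc n))) + (\<Sum>n. f (- int (Suc n))) = s - f 0"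
  using assms(1) unfolding esums_iff suminf_add[OF assms(2,3)] by (rule sums_unique[symmetric])

lemma esums_add: "f esums a \<Longrightarrow> g esums b \<Longrightarrow> (\<lambda>m. f m + g m) esums (a + b)"
  unfolding eisenstein_sums_def sum.distrib by (rule tendsto_add)

lemma esums_diff: "f esums a \<Longrightarrow> g esums b \<Longrightarrow> (\<lambda>m. f m - g m) esums (a - b)"
  unfolding eisenstein_sums_def sum_subtractf by (rule tendsto_diff)

lemma esums_mult:
  fixes c :: "'a::real_normed_algebra"
  shows "f esums a \<Longrightarrow> (\<lambda>m. c * f m) esums (c * a)"
  unfolding eisenstein_sums_def sum_distrib_left[symmetric] by (rule tendsto_mult_left)

lemma esums_mult2:
  fixes c :: "'a::real_normed_algebra"
  shows "f esums a \<Longrightarrow> (\<lambda>m. f m * c) esums (a * c)"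
  unfolding eisenstein_sums_def sum_distrib_right[symmetric] by (rule tendsto_mult_right)

lemma esums_sum: "(\<And>i. i \<in> I \<Longrightarrow> f i esums a i) \<Longrightarrow> (\<lambda>m. \<Sum>i\<in>I. f i m) esums (\<Sum>i\<in>I. a i)"
  unfolding eisenstein_sums_def by (subst sum.swap) (rule tendsto_sum)

lemma esums_of_real: "f esums a \<Longrightarrow> (\<lambda>m. of_real (f m)) esums of_real a"
  unfolding eisenstein_sums_def of_real_sum[symmetric] by (rule tendsto_of_real)

lemma esums_reflect: "f esums s \<Longrightarrow> (\<lambda>m. f (- m)) esums s"
  by (simp add: esums_iff add.commute)

lemma esums_If_0: "(\<lambda>m. if m = 0 then a else 0) esums a"
  by (simp add: esums_iff)

lemma esums_even:
  assumes "(\<lambda>m. f (2 * m)) esums s"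
  shows "(\<lambda>m. if even m then f m else 0) esums s"
proof -
  define h where "h m = (if even m then f m else 0)" for m
  define g where "g n = h (int (Suc n)) + h (- int (Suc n))" for n
  have "g (2 * n + 1) = f (2 * int (Suc n)) + f (2 * - int (Suc n))" for n
    by (simp add: g_def h_def algebra_simps)
  then have "(\<lambda>n. g (2 * n + 1)) sums (s - f 0)"
    using assms by (simp add: esums_iff)
  moreover have "g n = 0" if "n \<notin> range (\<lambda>n. 2 * n + 1)" for n
    using that by (auto simp: g_def h_def elim!: oddE)
  ultimately have "g sums (s - f 0)"
    by (subst (asm) sums_mono_reindex) (auto simp: strict_mono_def)
  then have "h esums s"
    by (simp add: esums_iff g_def[abs_def] h_def)
  then show ?thesis
    by (simp add: h_def[abs_def])
qed

lemma sums_swap_dominated: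
  fixes f :: "nat \<Rightarrow> nat \<Rightarrow> 'a::{real_normed_algebra,banach}"
  assumes bound: "\<And>n i. norm (f n i) \<le> g n * h i" and "summable g" and "summable h"
    and rows: "\<And>n. f n sums r n" and columns: "\<And>i. (\<lambda>n. f n i) sums c i"
  shows "c sums suminf r"
proof -
  have nonneg: "0 \<le> g n * h i" for n i
    using bound[of n i] norm_ge_zero[of "f n i"] by linarith
  have partial_bound: "norm (\<Sum>i<N. f n i) \<le> g n * suminf h" for n N
  proof -
    have "norm (\<Sum>i<N. f n i) \<le> (\<Sum>i<N. g n * h i)"
      by (rule sum_norm_le) (rule bound)
    also have "\<dots> \<le> (\<Sum>i. g n * h i)"
      using nonneg \<open>summable h\<close> by (intro sum_le_suminf summable_mult) auto
    also have "\<dots> = g n * suminf h"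
      using \<open>summable h\<close> by (rule suminf_mult)
    finally show ?thesis .
  qed
  have "(\<lambda>N. \<Sum>n. \<Sum>i<N. f n i) \<longlonglongrightarrow> suminf r"
  proof (intro tannerys_theorem[THEN conjunct2, THEN conjunct2])
    show "(\<lambda>N. \<Sum>i<N. f n i) \<longlonglongrightarrow> r n" for n
      using rows by (simp add: sums_def)
    show "\<forall>\<^sub>F (n, N) in sequentially \<times>\<^sub>F sequentially. norm (\<Sum>i<N. f n i) \<le> g n * suminf h"
      using partial_bound by (intro always_eventually) auto
    show "summable (\<lambda>n. g n * suminf h)"
      using \<open>summable g\<close> by (rule summable_mult2)
  qed simp
  moreover have "(\<Sum>n. \<Sum>i<N. f n i) = (\<Sum>i<N. c i)" for N
    by (intro sums_unique[symmetric] sums_sum columns)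
  ultimately show ?thesis
    by (simp add: sums_def)
qed

lemma esums_swap_dominated:
  fixes f :: "int \<Rightarrow> nat \<Rightarrow> 'a::{real_normed_algebra,banach}"
  assumes bound: "\<And>m i. m \<noteq> 0 \<Longrightarrow> norm (f m i) \<le> g \<bar>m\<bar> * h i"
    and "summable (\<lambda>n. g (int (Suc n)))" and "summable h"
    and rows: "\<And>m. f m sums r m" and columns: "\<And>i. (\<lambda>m. f m i) esums c i" and "r esums S"
  shows "c sums S"
proof -
  have "(\<lambda>i. c i - f 0 i) sums (\<Sum>n. r (int (Suc n)) + r (- int (Suc n)))"
  proof (rule sums_swap_dominated)
    show "norm (f (int (Suc n)) i + f (- int (Suc n)) i) \<le> 2 * g (int (Suc n)) * h i" for n i
      using bound[of "int (Suc n)" i] bound[of "- int (Suc n)" i]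
        norm_triangle_ineq[of "f (int (Suc n)) i" "f (- int (Suc n)) i"]
      by (simp del: of_nat_Suc)
    show "(\<lambda>i. f (int (Suc n)) i + f (- int (Suc n)) i) sums (r (int (Suc n)) + r (- int (Suc n)))" for n
      by (intro sums_add rows)
    show "(\<lambda>n. f (int (Suc n)) i + f (- int (Suc n)) i) sums (c i - f 0 i)" for i
      using columns by (simp only: esums_iff)
  qed (use assms in \<open>auto intro: summable_mult\<close>)
  also have "(\<Sum>n. r (int (Suc n)) + r (- int (Suc n))) = S - r 0"
    using \<open>r esums S\<close> by (simp add: esums_iff sums_iff)
  finally show ?thesis
    using sums_add[OF _ rows[of 0], of "\<lambda>i. c i - f 0 i" "S - r 0"] by simp
qed

lemma summable_inverse_square_Suc: "summable (\<lambda>n. 1 / real_of_int (int (Suc n)) ^ 2)"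
  using summable_Suc_iff[of "\<lambda>n. 1 / real n ^ 2"] inverse_power_summable[of 2, where ?'a = real]
  by (simp add: inverse_eq_divide)

lemma power_int_minus_one_Suc:
  "(-1 :: 'a::field) powi int (Suc n) = (-1) ^ Suc n"
  "(-1 :: 'a::field) powi (- int (Suc n)) = (-1) ^ Suc n"
  by (simp_all only: power_int_minus_one_minus power_int_of_nat)

subsection \<open>Euler's pentagonal number theorem\<close>

definition euler_function :: "'a::{real_normed_field,banach} \<Rightarrow> 'a" where
  "euler_function q = (\<Prod>i. 1 - q ^ Suc i)"

lemma euler_function_LIMSEQ:
  fixes q :: "'a::{real_normed_field,banach}"
  assumes "norm q < 1"
  shows "(\<lambda>n. \<Prod>i=1..n. 1 - q ^ i) \<longlonglongrightarrow> euler_function q"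
proof -
  have "summable (\<lambda>i. norm (1 - q ^ Suc i - 1))"
    using assms by (auto simp: norm_mult norm_power intro!: summable_mult summable_geometric)
  then have "(\<lambda>n. \<Prod>i\<le>n. 1 - q ^ Suc i) \<longlonglongrightarrow> euler_function q"
    unfolding euler_function_def
    by (intro convergent_prod_LIMSEQ
        abs_convergent_prod_imp_convergent_prod summable_imp_abs_convergent_prod)
  also have "(\<lambda>n. \<Prod>i\<le>n. 1 - q ^ Suc i) = (\<lambda>n. \<Prod>i=1..Suc n. 1 - q ^ i)"
    by (simp only: One_nat_def prod.atLeast1_atMost_eq lessThan_Suc_atMost)
  finally show ?thesis
    by (rule LIMSEQ_imp_Suc)
qed

lemma norm_prod_one_minus_power_le:
  fixes q :: "'a::real_normed_field"
  assumes "norm q < 1" "finite A"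
  shows "norm (\<Prod>i\<in>A. 1 - q ^ i) \<le> exp (1 / (1 - norm q))"
proof -
  have "norm (\<Prod>i\<in>A. 1 - q ^ i) \<le> (\<Prod>i\<in>A. 1 + norm q ^ i)"
    unfolding prod_norm[symmetric]
    by (intro prod_mono conjI norm_ge_zero norm_triangle_ineq4[THEN order_trans]) (simp add: norm_power)
  also have "\<dots> \<le> exp (\<Sum>i\<in>A. norm q ^ i)"
    by (rule prod_le_exp_sum) simp
  also have "(\<Sum>i\<in>A. norm q ^ i) \<le> (\<Sum>i. norm q ^ i)"
    using assms by (intro sum_le_suminf summable_geometric) auto
  also have "\<dots> = 1 / (1 - norm q)"
    using assms(1) by (simp add: suminf_geometric)
  finally show ?thesis by simp
qed

definition pentagonal :: "int \<Rightarrow> nat" where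
  "pentagonal m = nat (m * (3 * m - 1) div 2)"

lemma two_pentagonal: "2 * int (pentagonal m) = m * (3 * m - 1)"
proof -
  have "0 \<le> m * (3 * m - 1)"
    by (cases "m \<ge> 1") (auto intro: mult_nonpos_nonpos)
  then show ?thesis by (simp add: pentagonal_def)
qed

lemma pentagonal_0 [simp]: "pentagonal 0 = 0"
  by (simp add: pentagonal_def)

lemma pentagonal_ge_square: "real_of_int m ^ 2 \<le> real (pentagonal m)"
proof -
  have "m * 1 \<le> m * m"
    by (cases "m \<ge> 1") (auto intro: mult_left_mono order_trans[of m 0])
  then have "m ^ 2 \<le> int (pentagonal m)"
    using two_pentagonal[of m] by (simp add: power2_eq_square algebra_simps)
  then show ?thesis
    by (metis of_int_le_iff of_int_of_nat_eq of_int_power)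
qed

lemma pentagonal_pos: "m \<noteq> 0 \<Longrightarrow> 0 < pentagonal m"
  using pentagonal_ge_square[of m] by (auto intro!: Nat.gr0I)

lemma pentagonal_Suc:
  "pentagonal (int (Suc n)) = Suc n * Suc n + triangle n"
  "pentagonal (- int (Suc n)) = Suc n * Suc n + triangle (Suc n)"
proof -
  have "2 * int (triangle n) = int n * int (Suc n)"
    by (induction n) (simp_all add: algebra_simps)
  then have "2 * int (pentagonal (int (Suc n))) = 2 * int (Suc n * Suc n + triangle n)"
    "2 * int (pentagonal (- int (Suc n))) = 2 * int (Suc n * Suc n + triangle (Suc n))"
    unfolding two_pentagonal by (simp_all add: algebra_simps)
  then show "pentagonal (int (Suc n)) = Suc n * Suc n + triangle n"
    "pentagonal (- int (Suc n)) = Suc n * Suc n + triangle (Suc n)"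
    by (simp_all only: mult_left_cancel[OF zero_neq_numeral[symmetric]] of_nat_eq_iff)
qed

text \<open>
  Shanks' finite form of the theorem: this sum equals a partial sum of the pentagonal series, while
  all its terms except the one for \<open>s = 0\<close>, which is the partial Euler product, vanish in the limit.
\<close>
definition shanks_sum :: "'a::comm_ring_1 \<Rightarrow> nat \<Rightarrow> 'a" where
  "shanks_sum q n = (\<Sum>s\<le>n. (-1) ^ s * (\<Prod>i\<in>{s<..n}. 1 - q ^ i) * q ^ (s * n + triangle s))"

lemma shanks_sum_Suc:
  "shanks_sum q (Suc n) = shanks_sum q n
     + (-1) ^ Suc n * (q ^ (Suc n * Suc n + triangle n) + q ^ (Suc n * Suc n + triangle (Suc n)))"
proof -
  define R where "R s m = (\<Prod>i\<in>{s<..m}. 1 - q ^ i)" for s m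
  define a where "a s = (-1) ^ s * R s n * q ^ (s * n + triangle s)" for s
  define b where "b s = (-1) ^ s * R s n * q ^ (Suc s * n + Suc s + triangle s)" for s
  have R_self: "R m m = 1" for m
    by (simp add: R_def)
  have R_right: "R s (Suc n) = R s n * (1 - q ^ Suc n)" if "s \<le> n" for s
  proof -
    have "{s<..Suc n} = insert (Suc n) {s<..n}" using that by auto
    then show ?thesis by (simp add: R_def mult.commute)
  qed
  have R_left: "R s n = R (Suc s) n * (1 - q ^ Suc s)" if "s < n" for s
  proof -
    have "{s<..n} = insert (Suc s) {Suc s<..n}" using that by auto
    then show ?thesis by (simp add: R_def mult.commute)
  qed
  have shift: "a (Suc s) * (1 - q ^ Suc s) = - b s" if "s < n" for s
    unfolding a_def b_def R_left[OF that] by (simp add: power_add mult_ac)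
  have "shanks_sum q (Suc n) = (\<Sum>s\<le>n. a s - a s * (1 - q ^ s) - b s)
      + (-1) ^ Suc n * q ^ (Suc n * Suc n + triangle (Suc n))"
    by (simp add: shanks_sum_def a_def b_def R_self R_right power_add algebra_simps flip: R_def)
  also have "(\<Sum>s\<le>n. a s - a s * (1 - q ^ s) - b s) =
      (\<Sum>s\<le>n. a s) - (\<Sum>s<n. a (Suc s) * (1 - q ^ Suc s)) - (\<Sum>s\<le>n. b s)"
    by (simp add: sum_subtractf sum.atMost_shift[of "\<lambda>s. a s * (1 - q ^ s)"])
  also have "\<dots> = (\<Sum>s\<le>n. a s) - b n"
    using shift by (simp add: sum_negf flip: lessThan_Suc_atMost)
  finally show ?thesis
    by (simp add: shanks_sum_def a_def b_def R_self algebra_simps flip: R_def)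
qed

lemma shanks_identity:
  fixes q :: "'a::field"
  shows "shanks_sum q n = (\<Sum>m\<in>{- int n..int n}. (-1) powi m * q ^ pentagonal m)"
  unfolding sum_symmetric_int_atLeastAtMost power_int_minus_one_Suc pentagonal_Suc
proof (induction n)
  case (Suc n)
  then show ?case by (simp only: shanks_sum_Suc sum.lessThan_Suc distrib_left add.assoc)
qed (simp add: shanks_sum_def)

lemma norm_shanks_sum_diff_le:
  fixes q :: "'a::real_normed_field"
  assumes "norm q < 1"
  shows "norm (shanks_sum q n - (\<Prod>i=1..n. 1 - q ^ i)) \<le> exp (1 / (1 - norm q)) * (real n * norm q ^ n)"
proof -
  define R where "R s = (\<Prod>i\<in>{s<..n}. 1 - q ^ i)" for s
  have "{0<..n} = {1..n}" by auto
  then have "shanks_sum q n - (\<Prod>i=1..n. 1 - q ^ i) =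
      (\<Sum>s<n. (-1) ^ Suc s * R (Suc s) * q ^ (Suc s * n + triangle (Suc s)))"
    by (simp add: shanks_sum_def sum.atMost_shift R_def)
  also have "norm \<dots> \<le> (\<Sum>s<n. exp (1 / (1 - norm q)) * norm q ^ n)"
  proof (rule sum_norm_le)
    fix s
    have "norm (R (Suc s)) * norm q ^ (Suc s * n + triangle (Suc s))
        \<le> exp (1 / (1 - norm q)) * norm q ^ n"
      unfolding R_def using assms
      by (intro mult_mono norm_prod_one_minus_power_le power_decreasing) auto
    then show "norm ((-1) ^ Suc s * R (Suc s) * q ^ (Suc s * n + triangle (Suc s)))
        \<le> exp (1 / (1 - norm q)) * norm q ^ n"
      by (simp add: norm_mult norm_power)
  qed
  finally show ?thesis by (simp add: mult_ac)
qed

theorem pentagonal_number_theorem: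
  fixes q :: "'a::{real_normed_field,banach}"
  assumes "norm q < 1"
  shows "(\<lambda>m. (-1) powi m * q ^ pentagonal m) esums euler_function q"
proof -
  have "(\<lambda>n. exp (1 / (1 - norm q)) * (real n * norm q ^ n)) \<longlonglongrightarrow> 0"
    using assms by (intro tendsto_mult_right_zero powser_times_n_limit_0) simp
  then have "(\<lambda>n. shanks_sum q n - (\<Prod>i=1..n. 1 - q ^ i)) \<longlonglongrightarrow> 0"
    by (rule Lim_null_comparison[rotated]) (use norm_shanks_sum_diff_le[OF assms] in auto)
  from tendsto_add[OF this euler_function_LIMSEQ[OF assms]] show ?thesis
    by (simp add: eisenstein_sums_def flip: shanks_identity)
qed

subsection \<open>Partial fractions\<close>

lemma Digamma_reflection:
  fixes z :: complex
  assumes "z \<notin> \<int>"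
  shows "Digamma (1 - z) - Digamma z = of_real pi * cot (of_real pi * z)"
proof -
  have "z \<notin> \<int>\<^sub>\<le>\<^sub>0" "1 - z \<notin> \<int>\<^sub>\<le>\<^sub>0"
    using assms Ints_diff[of 1 "1 - z"] by (auto dest: nonpos_Ints_Int)
  then have "((\<lambda>z. rGamma z * rGamma (1 - z)) has_field_derivative
      rGamma z * rGamma (1 - z) * (Digamma (1 - z) - Digamma z)) (at z)"
    by (auto intro!: derivative_eq_intros simp: algebra_simps)
  moreover have "((\<lambda>z. sin (of_real pi * z) / of_real pi :: complex) has_field_derivative
      cos (of_real pi * z)) (at z)"
    by (auto intro!: derivative_eq_intros)
  ultimately have "sin (of_real pi * z) / of_real pi * (Digamma (1 - z) - Digamma z) =
      cos (of_real pi * z)"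
    unfolding rGamma_reflection_complex by (rule DERIV_unique)
  moreover have "sin (of_real pi * z) \<noteq> 0"
    using assms by (auto simp: sin_eq_0)
  ultimately show ?thesis by (simp add: cot_def field_simps)
qed

lemma cot_partial_fractions:
  fixes z :: complex
  assumes "z \<notin> \<int>"
  shows "(\<lambda>m. 1 / (z + of_int m)) esums (of_real pi * cot (of_real pi * z))"
proof -
  have Digamma_sums: "(\<lambda>n. inverse (of_nat (Suc n)) - inverse (w + of_nat n))
      sums (Digamma w + euler_mascheroni)"
    if "w \<noteq> 0" for w :: complex
    using summable_Digamma[OF that] by (simp add: Digamma_def summable_sums)
  have telescope: "(\<lambda>n. inverse (z + of_nat (Suc n)) - inverse (z + of_nat n))
      sums (0 - inverse (z + of_nat 0))"
    by (intro telescope_sums filterlim_compose[OF tendsto_inverse_0]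
              tendsto_add_filterlim_at_infinity[OF tendsto_const] tendsto_of_nat)
  have "z \<noteq> 0" "1 - z \<noteq> 0"
    using assms by auto
  then have "(\<lambda>n. inverse (z + of_nat (Suc n)) - inverse (1 - z + of_nat n)) sums
      (Digamma (1 - z) - Digamma z - inverse z)"
    using sums_add[OF sums_diff[OF Digamma_sums Digamma_sums] telescope, of "1 - z" z] by simp
  moreover have "inverse (1 - z + of_nat n) = - inverse (z + of_int (- int (Suc n)))" for n
    by (simp flip: inverse_minus_eq)
  ultimately show ?thesis
    using Digamma_reflection[OF assms] by (simp add: esums_iff inverse_eq_divide)
qed

lemma cot_diff_cot_double:
  fixes u :: "'a::{real_normed_field,banach}"
  assumes "sin (2 * u) \<noteq> 0"
  shows "cot u - cot (2 * u) = 1 / sin (2 * u)"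
proof -
  have "sin u \<noteq> 0"
    using assms by (auto simp: sin_double)
  then have "cot u - cot (2 * u) = (sin (2 * u) * cos u - cos (2 * u) * sin u) / (sin u * sin (2 * u))"
    using assms by (simp add: cot_def diff_frac_eq mult.commute)
  also have "\<dots> = 1 / sin (2 * u)"
    using \<open>sin u \<noteq> 0\<close> sin_diff[of "2 * u" u] by simp
  finally show ?thesis .
qed

lemma cosec_partial_fractions:
  fixes z :: complex
  assumes "z \<notin> \<int>"
  shows "(\<lambda>m. (-1) powi m / (z + of_int m)) esums (of_real pi / sin (of_real pi * z))"
proof -
  have half: "z / 2 \<notin> \<int>"
    using assms Ints_mult[of 2 "z / 2"] by auto
  have "1 / (z / 2 + of_int m) = 2 / (z + of_int (2 * m))" for m
  proof -
    have "z / 2 + of_int m = (z + of_int (2 * m)) / 2" by simp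
    then show ?thesis by (simp only: divide_divide_eq_right mult_1_left)
  qed
  then have "(\<lambda>m. if even m then 2 / (z + of_int m) else 0)
      esums (of_real pi * cot (of_real pi * (z / 2)))"
    using cot_partial_fractions[OF half] by (intro esums_even) (simp only:)
  from esums_diff[OF this cot_partial_fractions[OF assms]]
  have "(\<lambda>m. (if even m then 2 / (z + of_int m) else 0) - 1 / (z + of_int m)) esums
      (of_real pi * (cot (of_real pi * (z / 2)) - cot (2 * (of_real pi * (z / 2)))))"
    by (simp add: right_diff_distrib)
  moreover have "(if even m then 2 / (z + of_int m) else 0) - 1 / (z + of_int m) =
      (-1) powi m / (z + of_int m)" for m
    by (simp flip: diff_divide_distrib)
  moreover have "sin (2 * (of_real pi * (z / 2))) \<noteq> 0"
    using assms by (auto simp: sin_eq_0)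
  ultimately show ?thesis
    using cot_diff_cot_double[of "of_real pi * (z / 2)"] by simp
qed

lemma one_minus_mult_sum_binomial_power:
  fixes x :: "'a::comm_ring_1"
  shows "(1 - x) * (\<Sum>m\<le>p. of_nat (Suc q + m choose m) * x ^ m) =
    (\<Sum>m\<le>p. of_nat (q + m choose m) * x ^ m) - of_nat (Suc q + p choose p) * x ^ Suc p"
proof (induction p)
  case (Suc p)
  then show ?case
    by (simp only: sum.atMost_Suc distrib_left) (simp add: algebra_simps)
qed simp

text \<open>
  For \<open>x\<close> and \<open>y\<close> the success and failure probabilities of Bernoulli trials, the two summands are the
  probabilities that \<open>p + 1\<close> successes occur before \<open>q + 1\<close> failures and vice versa.
\<close>
lemma negative_binomial_sums_eq_1:
  fixes x y :: "'a::comm_ring_1"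
  assumes y: "y = 1 - x"
  shows "x ^ Suc p * (\<Sum>m\<le>q. of_nat (p + m choose m) * y ^ m)
    + y ^ Suc q * (\<Sum>m\<le>p. of_nat (q + m choose m) * x ^ m) = 1"
proof (induction q)
  case 0
  have "(1 - x) * (\<Sum>m\<le>p. x ^ m) = 1 - x ^ Suc p"
    using one_diff_power_eq[of x "Suc p"] by (simp only: lessThan_Suc_atMost)
  then show ?case by (simp add: y)
next
  case (Suc q)
  define d where "d = x ^ Suc p * (of_nat (p + Suc q choose Suc q) * y ^ Suc q)"
  have "x ^ Suc p * (\<Sum>m\<le>Suc q. of_nat (p + m choose m) * y ^ m) =
      x ^ Suc p * (\<Sum>m\<le>q. of_nat (p + m choose m) * y ^ m) + d"
    by (simp only: sum.atMost_Suc distrib_left d_def)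
  moreover have "y ^ Suc (Suc q) * (\<Sum>m\<le>p. of_nat (Suc q + m choose m) * x ^ m) =
      y ^ Suc q * (\<Sum>m\<le>p. of_nat (q + m choose m) * x ^ m) - d"
  proof -
    have "y ^ Suc (Suc q) * (\<Sum>m\<le>p. of_nat (Suc q + m choose m) * x ^ m) =
        y ^ Suc q * ((1 - x) * (\<Sum>m\<le>p. of_nat (Suc q + m choose m) * x ^ m))"
      by (simp add: y mult_ac)
    also have "\<dots> = y ^ Suc q * (\<Sum>m\<le>p. of_nat (q + m choose m) * x ^ m)
        - y ^ Suc q * (of_nat (Suc q + p choose p) * x ^ Suc p)"
      unfolding one_minus_mult_sum_binomial_power by (rule right_diff_distrib)
    also have "Suc q + p choose p = p + Suc q choose Suc q"
      using binomial_symmetric[of p "Suc q + p"] by (simp add: add.commute)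
    finally show ?thesis
      by (simp only: d_def mult_ac)
  qed
  ultimately show ?case
    using Suc by simp
qed

lemma sum_binomial_power_divide:
  fixes u v :: "'a::field"
  assumes "u \<noteq> 0" "v \<noteq> 0" "a \<ge> 1" "b \<ge> 1"
  shows "v ^ b * (\<Sum>m\<le>a-1. of_nat (b - 1 + m choose m) * u ^ m) / (u ^ a * v ^ b) =
    (\<Sum>i=1..a. of_nat (a + b - i - 1 choose (b - 1)) / u ^ i)"
proof -
  have "v ^ b * (\<Sum>m\<le>a-1. of_nat (b - 1 + m choose m) * u ^ m) / (u ^ a * v ^ b) =
      (\<Sum>m\<le>a-1. of_nat (b - 1 + m choose m) * u ^ m / u ^ a)"
    using assms by (simp add: sum_divide_distrib)
  also have "\<dots> = (\<Sum>i=1..a. of_nat (a + b - i - 1 choose (b - 1)) / u ^ i)"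
  proof (rule sum.reindex_bij_witness[of _ "\<lambda>i. a - i" "\<lambda>m. a - m"])
    fix m assume "m \<in> {..a - 1}"
    then have "a + b - (a - m) - 1 = b - 1 + m" "m \<le> a"
      using assms by auto
    moreover have "b - 1 + m choose m = b - 1 + m choose (b - 1)"
      using binomial_symmetric[of m "b - 1 + m"] by simp
    ultimately show "of_nat (a + b - (a - m) - 1 choose (b - 1)) / u ^ (a - m) =
        of_nat (b - 1 + m choose m) * u ^ m / u ^ a"
      using assms by (simp add: power_diff)
  qed (use assms in auto)
  finally show ?thesis .
qed

lemma partial_fractions_mult_powers:
  fixes x y :: "'a::field"
  assumes "x \<noteq> 0" "y \<noteq> 0" "x + y = 1" "a \<ge> 1" "b \<ge> 1"
  shows "1 / (x ^ a * y ^ b) = (\<Sum>i=1..a. of_nat (a + b - i - 1 choose (b - 1)) / x ^ i)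
    + (\<Sum>i=1..b. of_nat (a + b - i - 1 choose (a - 1)) / y ^ i)"
proof -
  have "1 = y ^ b * (\<Sum>m\<le>a-1. of_nat (b - 1 + m choose m) * x ^ m)
      + x ^ a * (\<Sum>m\<le>b-1. of_nat (a - 1 + m choose m) * y ^ m)"
    using negative_binomial_sums_eq_1[of y x "a - 1" "b - 1"] assms by (simp add: add.commute eq_diff_eq)
  then have "1 / (x ^ a * y ^ b) =
      y ^ b * (\<Sum>m\<le>a-1. of_nat (b - 1 + m choose m) * x ^ m) / (x ^ a * y ^ b)
      + x ^ a * (\<Sum>m\<le>b-1. of_nat (a - 1 + m choose m) * y ^ m) / (y ^ b * x ^ a)"
    by (simp only: add_divide_distrib[symmetric] mult.commute[of "y ^ b" "x ^ a"])
  then show ?thesis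
    by (simp only: sum_binomial_power_divide[OF assms(1,2,4,5)]
        sum_binomial_power_divide[OF assms(2,1,5,4)] add.commute[of b a])
qed

definition reflected_inverse_power :: "'a::field \<Rightarrow> nat \<Rightarrow> 'a" where
  "reflected_inverse_power x i = 1 / x ^ i + 1 / (1 - x) ^ i"

corollary partial_fractions_mult_one_minus_power:
  fixes x :: "'a::field"
  assumes "x \<noteq> 0" "x \<noteq> 1" "k \<ge> 1"
  shows "1 / (x * (1 - x)) ^ k =
    (\<Sum>i=1..k. of_nat (2 * k - i - 1 choose (k - 1)) * reflected_inverse_power x i)"
  using partial_fractions_mult_powers[of x "1 - x" k k] assms
  by (simp add: reflected_inverse_power_def power_mult_distrib distrib_left sum.distrib mult_2)

subsection \<open>Power series with Bernoulli coefficients\<close>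

definition bernoulli_fps :: "'a::real_normed_field \<Rightarrow> 'a fps" where
  "bernoulli_fps c = Abs_fps (\<lambda>n. c ^ n * of_real (bernoulli n / fact n))"

lemma bernoulli_fps_mult_exp_minus_one: "bernoulli_fps c * (fps_exp c - 1) = fps_const c * fps_X"
proof (rule fps_ext)
  fix n
  let ?B = "fps_X div (fps_exp (1::real) - 1)"
  have "subdegree (fps_exp (1::real) - 1) = 1"
    by (rule subdegreeI) auto
  then have "?B * (fps_exp 1 - 1) = fps_X"
    by (intro dvd_div_mult_self) (subst fps_dvd_iff, auto)
  moreover have "fps_nth (bernoulli_fps c * (fps_exp c - 1)) n =
      c ^ n * of_real (fps_nth (?B * (fps_exp 1 - 1)) n)"
    unfolding fps_mult_nth of_real_sum sum_distrib_left
  proof (rule sum.cong)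
    fix i assume "i \<in> {0..n}"
    then have "c ^ n = c ^ i * c ^ (n - i)"
      by (simp flip: power_add)
    moreover have "fps_nth (fps_exp c - 1) k = c ^ k * of_real (fps_nth (fps_exp 1 - 1) k)" for k
      by simp
    ultimately show "fps_nth (bernoulli_fps c) i * fps_nth (fps_exp c - 1) (n - i) =
        c ^ n * of_real (fps_nth ?B i * fps_nth (fps_exp 1 - 1) (n - i))"
      by (simp add: bernoulli_fps_def bernoulli_def mult_ac)
  qed simp
  ultimately show "fps_nth (bernoulli_fps c * (fps_exp c - 1)) n = fps_nth (fps_const c * fps_X) n"
    by (cases "n = 1") auto
qed

lemma bernoulli_0: "bernoulli 0 = 1"
  using arg_cong[OF bernoulli_fps_mult_exp_minus_one[of "1::real"], of "\<lambda>F. fps_nth F 1"]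
  by (simp add: fps_mult_nth bernoulli_fps_def)

lemma fps_sin_eq_0_iff: "fps_sin c = 0 \<longleftrightarrow> c = (0 :: 'a::field_char_0)"
proof
  assume "fps_sin c = 0"
  then have "fps_nth (fps_sin c) 1 = 0" by simp
  then show "c = 0" by simp
qed (auto simp: fps_sin_def fps_eq_iff elim!: oddE)

text \<open>\<open>z cot z = B(2\<i>z) + \<i>z\<close>, where \<open>B(z) = z / (e\<^sup>z - 1)\<close>.\<close>
definition cot_fps :: "complex \<Rightarrow> complex fps" where
  "cot_fps c = bernoulli_fps (2 * \<i> * c) + fps_const (\<i> * c) * fps_X"

lemma cot_fps_mult_sin: "cot_fps c * fps_sin c = fps_const c * fps_X * fps_cos c"
proof -
  define I where "I = fps_const \<i>"
  define E where "E = fps_exp (\<i> * c)"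
  define E' where "E' = fps_exp (- (\<i> * c))"
  have E'_mult_E: "E' * E = 1"
    unfolding E_def E'_def fps_exp_add_mult[symmetric] by simp
  have E_mult_E: "E * E = fps_exp (2 * \<i> * c)"
    by (simp add: E_def fps_exp_add_mult[symmetric])
  have sin: "2 * I * fps_sin c = E - E'" and cos: "2 * fps_cos c = E + E'"
    unfolding E_def E'_def I_def fps_exp_minus_ii_sin_cos fps_exp_ii_sin_cos
    by (simp_all add: algebra_simps)
  have two_sin: "2 * I * E * fps_sin c = E * E - 1" and two_cos: "2 * E * fps_cos c = E * E + 1"
    using arg_cong[OF sin, of "\<lambda>F. E * F"] arg_cong[OF cos, of "\<lambda>F. E * F"] E'_mult_E
    by (simp_all add: algebra_simps)
  have "2 * I * E * (cot_fps c * fps_sin c) = cot_fps c * (E * E - 1)"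
    unfolding two_sin[symmetric] by (simp add: mult_ac)
  also have "\<dots> = fps_const (2 * \<i> * c) * fps_X + fps_const (\<i> * c) * fps_X * (E * E - 1)"
    using bernoulli_fps_mult_exp_minus_one[of "2 * \<i> * c"]
    by (simp add: cot_fps_def distrib_right E_mult_E)
  also have "\<dots> = I * fps_const c * fps_X * (E * E + 1)"
    by (simp add: I_def algebra_simps flip: fps_const_mult numeral_fps_const)
  also have "\<dots> = 2 * I * E * (fps_const c * fps_X * fps_cos c)"
    unfolding two_cos[symmetric] by (simp add: mult_ac)
  finally show ?thesis
    by (simp add: E_def I_def)
qed

lemma cot_fps_0 [simp]: "cot_fps 0 = 1"
  by (auto simp: cot_fps_def bernoulli_fps_def fps_eq_iff bernoulli_0 power_0_left)

lemma cot_fps_minus: "cot_fps (- c) = cot_fps c"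
proof (cases "c = 0")
  case False
  have "cot_fps (- c) * fps_sin c = cot_fps c * fps_sin c"
    using cot_fps_mult_sin[of "- c"]
    by (simp add: cot_fps_mult_sin fps_sin_even fps_cos_odd flip: fps_const_neg)
  with False show ?thesis
    by (simp add: fps_sin_eq_0_iff)
qed simp

lemma cot_fps_nth_odd:
  assumes "odd n"
  shows "fps_nth (cot_fps c) n = 0"
proof -
  have "fps_nth (cot_fps (- c)) n = - fps_nth (cot_fps c) n"
    using assms by (auto simp: cot_fps_def bernoulli_fps_def)
  then show ?thesis
    by (simp add: cot_fps_minus)
qed

lemma cot_fps_nth_even:
  "fps_nth (cot_fps c) (2 * j) =
    (-1) ^ j * (2 * c) ^ (2 * j) * of_real (bernoulli (2 * j)) / fact (2 * j)"
proof -
  have "(2 * \<i> * c) ^ (2 * j) = (\<i> ^ 2) ^ j * (2 * c) ^ (2 * j)"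
    by (simp add: power_mult_distrib flip: power_mult)
  moreover have "2 * j \<noteq> 1" by presburger
  ultimately show ?thesis
    by (simp add: cot_fps_def bernoulli_fps_def)
qed

text \<open>\<open>z / sin z = z cot (z / 2) - z cot z\<close>.\<close>
definition cosec_fps :: "complex \<Rightarrow> complex fps" where
  "cosec_fps c = 2 * cot_fps (c / 2) - cot_fps c"

lemma cosec_fps_mult_sin: "cosec_fps c * fps_sin c = fps_const c * fps_X"
proof -
  define s where "s = fps_sin (c / 2)"
  define k where "k = fps_cos (c / 2)"
  define a where "a = fps_const (c / 2) * fps_X"
  have sin_c: "fps_sin c = 2 * s * k" and cos_c: "fps_cos c = k * k - s * s"
    using fps_sin_add[of "c / 2" "c / 2"] fps_cos_add[of "c / 2" "c / 2"] by (simp_all add: s_def k_def)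
  have two_a: "fps_const c * fps_X = 2 * a"
    by (simp add: a_def flip: numeral_fps_const mult.assoc)
  have half: "cot_fps (c / 2) * s = a * k"
    by (simp only: cot_fps_mult_sin a_def k_def s_def)
  have whole: "cot_fps c * fps_sin c = 2 * a * (k * k - s * s)"
    by (simp only: cot_fps_mult_sin two_a cos_c)
  have "cosec_fps c * fps_sin c = 4 * k * (cot_fps (c / 2) * s) - cot_fps c * fps_sin c"
    by (simp add: cosec_fps_def sin_c algebra_simps)
  also have "\<dots> = 4 * k * (a * k) - 2 * a * (k * k - s * s)"
    unfolding half whole ..
  also have "\<dots> = 2 * a * (k\<^sup>2 + s\<^sup>2)"
    by (simp add: algebra_simps power2_eq_square)
  finally show ?thesis
    by (simp add: k_def s_def fps_sin_cos_sum_of_squares two_a)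
qed

lemma cosec_fps_mult_cos: "cosec_fps c * fps_cos c = cot_fps c"
proof (cases "c = 0")
  case False
  have "cosec_fps c * fps_cos c * fps_sin c = cot_fps c * fps_sin c"
    unfolding cot_fps_mult_sin cosec_fps_mult_sin[symmetric] by (simp only: mult_ac)
  with False show ?thesis
    by (simp add: fps_sin_eq_0_iff)
qed (simp add: cosec_fps_def)

lemma cosec_fps_mult_sin_diff:
  "cosec_fps a * fps_sin (a - b) = fps_const a * fps_X * fps_cos b - cot_fps a * fps_sin b"
proof -
  have "fps_sin (a - b) = fps_sin a * fps_cos b - fps_cos a * fps_sin b"
    using fps_sin_add[of a "- b"] by (simp add: fps_sin_even fps_cos_odd)
  then have "cosec_fps a * fps_sin (a - b) =
      cosec_fps a * fps_sin a * fps_cos b - cosec_fps a * fps_cos a * fps_sin b"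
    by (simp add: right_diff_distrib mult.assoc)
  then show ?thesis
    by (simp only: cosec_fps_mult_sin cosec_fps_mult_cos)
qed

lemma has_fps_expansion_cosec:
  assumes "c \<noteq> 0"
  shows "(\<lambda>z. if z = 0 then 1 else c * z / sin (c * z)) has_fps_expansion cosec_fps c"
proof -
  have "fps_sin c \<noteq> 0" "subdegree (fps_sin c) = 1"
    using assms by (auto simp: fps_sin_eq_0_iff intro: subdegreeI)
  then have "(\<lambda>z. if z = 0 then 1 else c * z / sin (c * z))
      has_fps_expansion (fps_const c * fps_X / fps_sin c)"
    using assms by (intro has_fps_expansion_divide fps_expansion_intros) auto
  moreover have "fps_const c * fps_X / fps_sin c = cosec_fps c"
    using \<open>fps_sin c \<noteq> 0\<close> by (simp add: fps_divide_times_eq flip: cosec_fps_mult_sin)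
  ultimately show ?thesis by simp
qed

lemma cosec_fps_nth_odd: "odd n \<Longrightarrow> fps_nth (cosec_fps c) n = 0"
  by (simp add: cosec_fps_def cot_fps_nth_odd numeral_fps_const)

lemma cosec_fps_nth_even:
  "fps_nth (cosec_fps c) (2 * j) =
    (-1) ^ j * c ^ (2 * j) * (2 - 2 ^ (2 * j)) * of_real (bernoulli (2 * j)) / fact (2 * j)"
  by (simp add: cosec_fps_def cot_fps_nth_even numeral_fps_const power_mult_distrib)
     (simp add: diff_divide_distrib algebra_simps)

lemma sum_even_indices:
  fixes f :: "nat \<Rightarrow> 'a::comm_monoid_add"
  assumes "\<And>i. odd i \<Longrightarrow> f i = 0"
  shows "(\<Sum>i=0..2*j+1. f i) = (\<Sum>l=0..j. f (2 * l))"
  by (induction j) (simp_all add: assms)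

lemma cosec_fps_mult_sin_nth_even: "fps_nth (cosec_fps a * fps_sin b) (2 * j) = 0"
  unfolding fps_mult_nth
proof (intro sum.neutral ballI)
  fix i assume "i \<in> {0..2 * j}"
  then show "fps_nth (cosec_fps a) i * fps_nth (fps_sin b) (2 * j - i) = 0"
    by (cases "odd i") (auto simp: cosec_fps_nth_odd fps_sin_def)
qed

lemma fps_sin_nth_odd: "fps_nth (fps_sin c) (2 * j + 1) = (-1) ^ j * c ^ (2 * j + 1) / fact (2 * j + 1)"
  by (simp add: fps_sin_def del: fact_Suc)

lemma fps_cos_nth_even: "fps_nth (fps_cos c) (2 * j) = (-1) ^ j * c ^ (2 * j) / fact (2 * j)"
  by (simp add: fps_cos_def)

lemma cot_fps_mult_sin_nth_odd:
  "fps_nth (cot_fps a * fps_sin b) (2 * j + 1) = (-1) ^ j *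
    (\<Sum>l=0..j. (2 * a) ^ (2*l) * b ^ (2*j-2*l+1) * of_real (bernoulli (2*l))
      / (fact (2*j-2*l+1) * fact (2*l)))"
proof -
  have "fps_nth (cot_fps a * fps_sin b) (2 * j + 1) =
      (\<Sum>l=0..j. fps_nth (cot_fps a) (2 * l) * fps_nth (fps_sin b) (2 * j + 1 - 2 * l))"
    unfolding fps_mult_nth by (rule sum_even_indices) (simp add: cot_fps_nth_odd)
  also have "\<dots> = (-1) ^ j *
    (\<Sum>l=0..j. (2 * a) ^ (2*l) * b ^ (2*j-2*l+1) * of_real (bernoulli (2*l))
      / (fact (2*j-2*l+1) * fact (2*l)))"
    unfolding sum_distrib_left
  proof (rule sum.cong)
    fix l assume "l \<in> {0..j}"
    then have "2 * j + 1 - 2 * l = 2 * (j - l) + 1" "2 * j - 2 * l + 1 = 2 * (j - l) + 1"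
      and "(-1 :: complex) ^ j = (-1) ^ l * (-1) ^ (j - l)"
      by (auto simp flip: power_add)
    then show "fps_nth (cot_fps a) (2 * l) * fps_nth (fps_sin b) (2 * j + 1 - 2 * l) =
        (-1) ^ j * ((2 * a) ^ (2*l) * b ^ (2*j-2*l+1) * of_real (bernoulli (2*l))
          / (fact (2*j-2*l+1) * fact (2*l)))"
      by (simp only: cot_fps_nth_even fps_sin_nth_odd)
         (simp only: times_divide_eq_left times_divide_eq_right divide_divide_eq_left mult_ac)
  qed simp
  finally show ?thesis .
qed

subsection \<open>The generating function of the lattice sums\<close>

lemma norm_inverse_power_le:
  fixes y :: "'a::real_normed_field"
  assumes "norm y \<ge> 1" "n \<le> i"
  shows "norm (1 / y ^ i) \<le> 1 / norm y ^ n"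
proof -
  have "norm y > 0" using assms(1) by linarith
  then show ?thesis
    using assms by (auto simp: norm_divide norm_power intro!: frac_le power_increasing)
qed

lemma norm_reflected_inverse_power_le:
  fixes x :: "'a::real_normed_field"
  assumes "norm x \<ge> 2" "i \<ge> 1"
  shows "norm (reflected_inverse_power x i) \<le> 5 / norm x ^ 2"
proof -
  have half: "norm x / 2 \<le> norm (1 - x)"
    using norm_triangle_ineq2[of x 1] assms(1) by (simp add: norm_minus_commute)
  have nz: "norm x > 0" "norm (1 - x) > 0"
    using half assms(1) by linarith+
  consider "i = 1" | "i \<ge> 2" using assms(2) by linarith
  then show ?thesis
  proof cases
    case 1
    have "reflected_inverse_power x i = 1 / (x * (1 - x))"
      using nz 1 by (simp add: reflected_inverse_power_def field_simps)
    then have "norm (reflected_inverse_power x i) = 1 / (norm x * norm (1 - x))"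
      by (simp add: norm_divide norm_mult)
    also have "\<dots> \<le> 5 / (norm x * (2 * norm (1 - x)))"
      using nz by (simp add: field_simps)
    also have "\<dots> \<le> 5 / norm x ^ 2"
      using nz half unfolding power2_eq_square
      by (intro divide_left_mono mult_left_mono mult_pos_pos) auto
    finally show ?thesis .
  next
    case 2
    have "norm (reflected_inverse_power x i) \<le> norm (1 / x ^ i) + norm (1 / (1 - x) ^ i)"
      unfolding reflected_inverse_power_def by (rule norm_triangle_ineq)
    also have "\<dots> \<le> 1 / norm x ^ 2 + 1 / norm (1 - x) ^ 2"
      using half assms(1) 2 by (intro add_mono norm_inverse_power_le) auto
    also have "1 / norm (1 - x) ^ 2 \<le> 1 / (norm x / 2) ^ 2"
      using half nz by (intro divide_left_mono power_mono) auto
    finally show ?thesis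
      by (simp add: power_divide)
  qed
qed

text \<open>
  For \<open>i \<ge> 1\<close> division by zero makes the summand \<open>(3m)\<^bsup>-i\<^esup>\<close> vanish at \<open>m = 0\<close>, where
  \<open>(1 - 3m)\<^bsup>-i\<^esup>\<close> contributes 1.
\<close>
definition lattice_term :: "nat \<Rightarrow> int \<Rightarrow> real" where
  "lattice_term i m = (-1) powi m * reflected_inverse_power (3 * of_int m) i"

definition lattice_sum :: "nat \<Rightarrow> real" where
  "lattice_sum i = lim (\<lambda>N. \<Sum>m\<in>{- int N..int N}. lattice_term i m)"

lemma abs_lattice_term_le:
  assumes "i \<ge> 1" "m \<noteq> 0"
  shows "\<bar>lattice_term i m\<bar> \<le> 1 / real_of_int m ^ 2"
proof -
  have "\<bar>lattice_term i m\<bar> = norm (reflected_inverse_power (3 * real_of_int m) i)"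
    by (simp add: lattice_term_def abs_mult flip: power_int_abs)
  also have "\<dots> \<le> 5 / norm (3 * real_of_int m) ^ 2"
    using assms by (intro norm_reflected_inverse_power_le) auto
  also have "\<dots> \<le> 1 / real_of_int m ^ 2"
    using assms(2) by (simp add: field_simps)
  finally show ?thesis .
qed

lemma lattice_term_esums:
  assumes "i \<ge> 1"
  shows "lattice_term i esums lattice_sum i"
proof -
  have "summable (\<lambda>n. lattice_term i (int (Suc n)) + lattice_term i (- int (Suc n)))"
  proof (rule summable_comparison_test'[OF summable_mult[OF summable_inverse_square_Suc, of 2]])
    show "norm (lattice_term i (int (Suc n)) + lattice_term i (- int (Suc n)))
        \<le> 2 * (1 / real_of_int (int (Suc n)) ^ 2)" for n
      using abs_lattice_term_le[OF assms, of "int (Suc n)"]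
        abs_lattice_term_le[OF assms, of "- int (Suc n)"]
      by (simp only: of_int_minus power2_minus) simp
  qed
  then obtain s where "lattice_term i esums (s + lattice_term i 0)"
    by (auto simp: summable_def esums_iff)
  then show ?thesis
    unfolding eisenstein_sums_def lattice_sum_def using limI by metis
qed

lemma sums_geometric_quotient:
  fixes t a :: "'a::{real_normed_field,banach}"
  assumes "norm t < norm a"
  shows "(\<lambda>i. t ^ Suc i / a ^ Suc i) sums (t / (a - t))"
proof -
  have "a \<noteq> 0" using assms by auto
  then have "(\<lambda>i. (t / a) * (t / a) ^ i) sums ((t / a) * (1 / (1 - t / a)))"
    using assms by (intro sums_mult geometric_sums) (simp add: norm_divide)
  moreover have "a * (1 - t / a) = a - t"
    using \<open>a \<noteq> 0\<close> by (simp add: right_diff_distrib)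
  ultimately show ?thesis
    by (simp add: power_divide)
qed

lemma not_Ints_norm_less_1:
  fixes z :: complex
  assumes "z \<noteq> 0" "norm z < 1"
  shows "z \<notin> \<int>"
  using assms by (auto elim!: Ints_cases)

lemma cosec_partial_fractions_third:
  fixes t w :: complex
  assumes "w / 3 \<notin> \<int>"
  shows "(\<lambda>m. (-1) powi m * (t / (w - 3 * of_int m)))
      esums (of_real pi / 3 * t / sin (of_real pi / 3 * w))"
proof -
  have "(\<lambda>m. t / 3 * ((-1) powi (- m) / (w / 3 + of_int (- m)))) esums
      (t / 3 * (of_real pi / sin (of_real pi * (w / 3))))"
    by (intro esums_mult esums_reflect[OF cosec_partial_fractions] assms)
  moreover have "t / 3 * ((-1) powi (- m) / (w / 3 + of_int (- m))) =
      (-1) powi m * (t / (w - 3 * of_int m))" for m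
  proof -
    have "w / 3 + of_int (- m) = (w - 3 * of_int m) / 3" by simp
    then show ?thesis
      by (simp only: power_int_minus_one_minus divide_divide_eq_right) simp
  qed
  ultimately show ?thesis
    by (simp add: power_int_minus_one_minus mult_ac)
qed

definition lattice_series :: "complex \<Rightarrow> int \<Rightarrow> complex" where
  "lattice_series t m = (-1) powi m *
     ((if m = 0 then 0 else t / (3 * of_int m - t)) + t / (1 - 3 * of_int m - t))"

lemma lattice_term_sums_lattice_series:
  assumes "norm t < 1"
  shows "(\<lambda>i. of_real (lattice_term (Suc i) m) * t ^ Suc i) sums lattice_series t m"
proof -
  have "1 - 3 * m \<noteq> 0" by presburger
  then have "norm t < norm (complex_of_int (1 - 3 * m))"
    using assms unfolding norm_of_int by linarith
  then have "(\<lambda>i. t ^ Suc i / (1 - 3 * of_int m) ^ Suc i) sums (t / (1 - 3 * of_int m - t))"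
    by (intro sums_geometric_quotient) simp
  moreover have "(\<lambda>i. t ^ Suc i / (3 * of_int m) ^ Suc i)
      sums (if m = 0 then 0 else t / (3 * of_int m - t))"
  proof (cases "m = 0")
    case False
    then have "norm t < norm (complex_of_int (3 * m))"
      using assms unfolding norm_of_int by linarith
    then show ?thesis
      using False sums_geometric_quotient[of t "3 * of_int m"] by simp
  qed simp
  ultimately have "(\<lambda>i. (-1) powi m * (t ^ Suc i / (3 * of_int m) ^ Suc i
      + t ^ Suc i / (1 - 3 * of_int m) ^ Suc i))
      sums lattice_series t m"
    unfolding lattice_series_def by (intro sums_mult sums_add)
  then show ?thesis
    by (simp add: lattice_term_def reflected_inverse_power_def algebra_simps)
qed

lemma lattice_series_esums:
  fixes t :: complex
  assumes "t \<noteq> 0" "norm t < 1"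
  defines "c \<equiv> complex_of_real pi / 3"
  shows "lattice_series t esums (1 + c * t / sin (c * (1 - t)) - c * t / sin (c * t))"
proof -
  have "norm (1 - t) \<le> 2"
    using norm_triangle_ineq4[of 1 t] assms(2) by simp
  then have "(1 - t) / 3 \<notin> \<int>" "t / 3 \<notin> \<int>"
    by (intro not_Ints_norm_less_1; use assms in \<open>force simp: norm_divide\<close>)+
  then have "(\<lambda>m. (if m = 0 then 1 else 0) + (-1) powi m * (t / (1 - t - 3 * of_int m))
        - (-1) powi m * (t / (t - 3 * of_int m))) esums
      (1 + c * t / sin (c * (1 - t)) - c * t / sin (c * t))"
    unfolding c_def by (intro esums_add esums_diff esums_If_0 cosec_partial_fractions_third)
  moreover have "(if m = 0 then 1 else 0) + (-1) powi m * (t / (1 - t - 3 * of_int m))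
      - (-1) powi m * (t / (t - 3 * of_int m)) = lattice_series t m" for m
  proof -
    have "t / (3 * of_int m - t) = - (t / (t - 3 * of_int m))"
      by (simp add: minus_divide_right)
    moreover have "1 - 3 * of_int m - t = 1 - t - 3 * of_int m"
      by simp
    ultimately show ?thesis
      using \<open>t \<noteq> 0\<close> by (simp add: lattice_series_def right_diff_distrib)
  qed
  ultimately show ?thesis by simp
qed

definition lattice_fps :: "complex fps" where
  "lattice_fps = Abs_fps (\<lambda>i. if i = 0 then 0 else of_real (lattice_sum i))"

lemma lattice_fps_sums:
  fixes t :: complex
  assumes "t \<noteq> 0" "norm t < 1"
  defines "c \<equiv> complex_of_real pi / 3"
  shows "(\<lambda>i. fps_nth lattice_fps i * t ^ i) sums (1 + c * t / sin (c * (1 - t)) - c * t / sin (c * t))"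
proof -
  have "(\<lambda>i. of_real (lattice_sum (Suc i)) * t ^ Suc i) sums
      (1 + c * t / sin (c * (1 - t)) - c * t / sin (c * t))"
  proof (rule esums_swap_dominated)
    show "norm (of_real (lattice_term (Suc i) m) * t ^ Suc i) \<le> 1 / of_int \<bar>m\<bar> ^ 2 * norm t ^ Suc i"
      if "m \<noteq> 0" for m i
      unfolding norm_mult norm_power norm_of_real
      using abs_lattice_term_le[of "Suc i" m] that by (intro mult_right_mono) auto
    show "summable (\<lambda>n. 1 / real_of_int (int (Suc n)) ^ 2)"
      by (rule summable_inverse_square_Suc)
    show "summable (\<lambda>i. norm t ^ Suc i)"
      using assms(2) by (simp add: summable_geometric summable_mult)
    show "(\<lambda>m. of_real (lattice_term (Suc i) m) * t ^ Suc i)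
        esums (of_real (lattice_sum (Suc i)) * t ^ Suc i)" for i
      by (intro esums_mult2 esums_of_real lattice_term_esums) simp
    show "lattice_series t esums (1 + c * t / sin (c * (1 - t)) - c * t / sin (c * t))"
      unfolding c_def by (rule lattice_series_esums[OF assms(1,2)])
  qed (rule lattice_term_sums_lattice_series[OF assms(2)])
  then have "(\<lambda>i. fps_nth lattice_fps (Suc i) * t ^ Suc i) sums
      (1 + c * t / sin (c * (1 - t)) - c * t / sin (c * t))"
    by (simp add: lattice_fps_def)
  then show ?thesis
    by (subst (asm) sums_Suc_iff) (simp add: lattice_fps_def)
qed

lemma cosec_pi_third_minus:
  fixes u :: complex
  assumes "sin (3 * u) \<noteq> 0"
  shows "1 / sin (of_real pi / 3 - u) =
    3 / 2 / sin (3 * u) - 1 / 2 / sin u + of_real (sqrt 3) * sin (2 * u) / sin (3 * u)"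
proof -
  define s k q where "s = sin u" and "k = cos u" and "q = complex_of_real (sqrt 3)"
  have q_sq: "q * q = 3"
    unfolding q_def of_real_mult[symmetric] by simp
  have k_sq: "k * k = 1 - s * s"
    using sin_cos_squared_add[of u] by (simp add: s_def k_def power2_eq_square algebra_simps)
  have sin_third: "sin (complex_of_real pi / 3) = q / 2"
    and cos_third: "cos (complex_of_real pi / 3) = 1 / 2"
    using sin_of_real[of "pi / 3", where ?'a = complex] cos_of_real[of "pi / 3", where ?'a = complex]
    by (simp_all add: sin_60 cos_60 q_def)
  have sin_minus: "sin (of_real pi / 3 - u) = (q * k - s) / 2"
    unfolding sin_diff sin_third cos_third by (simp add: s_def k_def diff_divide_distrib)
  have sin_2: "sin (2 * u) = 2 * s * k"
    by (simp add: sin_double s_def k_def)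
  have "sin (3 * u) = sin (2 * u + u)" by (simp add: algebra_simps)
  also have "\<dots> = s * (3 * (k * k) - s * s)"
    unfolding sin_add sin_double cos_double by (simp add: s_def k_def power2_eq_square algebra_simps)
  finally have sin_3: "sin (3 * u) = s * (3 * (k * k) - s * s)" .
  also have "\<dots> = s * (q * k + s) * (q * k - s)"
    unfolding q_sq[symmetric] by (simp add: algebra_simps)
  finally have "sin (3 * u) / ((q * k - s) / 2) = 2 * s * (q * k + s)" "s \<noteq> 0"
    using assms by auto
  moreover have "sin (3 * u) / s = 3 - 4 * s * s"
    using \<open>s \<noteq> 0\<close> by (simp add: sin_3) (simp add: k_sq)
  ultimately have "sin (3 * u) * (1 / sin (of_real pi / 3 - u)) =
      sin (3 * u) * (3 / 2 / sin (3 * u) - 1 / 2 / sin u + q * sin (2 * u) / sin (3 * u))"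
    using assms unfolding sin_minus sin_2 s_def[symmetric] by (simp add: algebra_simps)
  then show ?thesis
    by (simp only: mult_left_cancel[OF assms] q_def)
qed

lemma cosec_pi_third_one_minus:
  fixes t :: complex
  assumes "t \<noteq> 0" "norm t < 1"
  defines "u \<equiv> complex_of_real pi / 3 * t"
  shows "u / sin (of_real pi / 3 * (1 - t)) =
    1/2 * (3 * u / sin (3 * u)) - 1/2 * (u / sin u)
        + of_real (sqrt 3) / 3 * (3 * u / sin (3 * u) * sin (2 * u))"
proof -
  have sin_3u: "sin (3 * u) \<noteq> 0"
    using not_Ints_norm_less_1[OF assms(1,2)] by (auto simp: u_def sin_eq_0)
  have "of_real pi / 3 * (1 - t) = of_real pi / 3 - u"
    by (simp add: u_def right_diff_distrib)
  then have "u / sin (of_real pi / 3 * (1 - t)) = u * (1 / sin (of_real pi / 3 - u))"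
    by (simp only: times_divide_eq_right mult_1_right)
  also have "\<dots> = u * (3 / 2 / sin (3 * u) - 1 / 2 / sin u
      + of_real (sqrt 3) * sin (2 * u) / sin (3 * u))"
    unfolding cosec_pi_third_minus[OF sin_3u] ..
  finally show ?thesis
    by (simp add: algebra_simps)
qed

lemma lattice_fps_eq:
  defines "c \<equiv> complex_of_real pi / 3"
  shows "lattice_fps = 1 + fps_const (1/2) * cosec_fps (3 * c) - fps_const (3/2) * cosec_fps c
    + fps_const (of_real (sqrt 3) / 3) * (cosec_fps (3 * c) * fps_sin (2 * c))"
    (is "_ = ?F")
proof -
  define g where "g a z = (if z = 0 then 1 else a * z / sin (a * z))" for a z :: complex
  define f where "f z = 1 + 1/2 * g (3 * c) z - 3/2 * g c z
      + of_real (sqrt 3) / 3 * (g (3 * c) z * sin (2 * c * z))" for z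
  have "c \<noteq> 0" by (simp add: c_def)
  then have "f has_fps_expansion ?F"
    unfolding f_def g_def by (intro fps_expansion_intros has_fps_expansion_cosec) auto
  moreover have "f has_fps_expansion lattice_fps"
  proof (rule has_fps_expansionI)
    have "eventually (\<lambda>t::complex. norm t < 1) (nhds 0)"
      using eventually_nhds_in_open[of "ball 0 1" "0 :: complex"] by (simp add: dist_norm)
    then show "eventually (\<lambda>t. (\<lambda>i. fps_nth lattice_fps i * t ^ i) sums f t) (nhds 0)"
    proof eventually_elim
      fix t :: complex assume t: "norm t < 1"
      show "(\<lambda>i. fps_nth lattice_fps i * t ^ i) sums f t"
      proof (cases "t = 0")
        case True
        then show ?thesis by (simp add: powser_sums_zero_iff f_def g_def lattice_fps_def)
      next
        case False
        have "f t = 1 + c * t / sin (c * (1 - t)) - c * t / sin (c * t)"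
          using False cosec_pi_third_one_minus[OF False t] by (simp add: f_def g_def c_def algebra_simps)
        with lattice_fps_sums[OF False t] show ?thesis
          by (simp add: c_def)
      qed
    qed
  qed
  ultimately show ?thesis
    by (rule fps_expansion_unique_complex[rotated])
qed

subsection \<open>Values of the lattice sums\<close>

lemma lattice_sum_even:
  assumes "j \<ge> 1"
  shows "lattice_sum (2 * j) =
    - ((-1) ^ j * pi ^ (2*j) * bernoulli (2*j) / fact (2*j) * (2 ^ (2*j-1) - 1) * (1 - 3 / 3 ^ (2*j)))"
proof -
  define Z where "Z = (-1) ^ j * (2 - 2 ^ (2*j)) * bernoulli (2*j) / fact (2*j)"
  define t :: real where "t = 2 ^ (2*j-1) - 1"
  have two_powers: "(2::real) - 2 ^ (2*j) = - 2 * t"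
    using assms power_Suc[of "2::real" "2*j-1"] by (simp add: t_def)
  have cosec: "fps_nth (cosec_fps (of_real x)) (2 * j) = of_real (x ^ (2*j) * Z)" for x
    by (simp add: cosec_fps_nth_even Z_def)
  have "complex_of_real (lattice_sum (2 * j)) = fps_nth lattice_fps (2 * j)"
    using assms by (simp add: lattice_fps_def)
  also have "\<dots> = 1 / 2 * fps_nth (cosec_fps (of_real pi)) (2 * j)
      - 3 / 2 * fps_nth (cosec_fps (of_real (pi / 3))) (2 * j)"
    using assms by (simp add: lattice_fps_eq cosec_fps_mult_sin_nth_even)
  also have "\<dots> = of_real ((pi ^ (2*j) / 2 - 3 / 2 * (pi / 3) ^ (2*j)) * Z)"
    unfolding cosec by (simp add: left_diff_distrib)
  finally have "lattice_sum (2 * j) = (pi ^ (2*j) / 2 - 3 / 2 * (pi / 3) ^ (2*j)) * Z"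
    by (simp only: of_real_eq_iff)
  also have "pi ^ (2*j) / 2 - 3 / 2 * (pi / 3) ^ (2*j) = pi ^ (2*j) * (1 - 3 / 3 ^ (2*j)) / 2"
    by (simp add: power_divide right_diff_distrib diff_divide_distrib)
  also have "Z = - 2 * ((-1) ^ j * t * bernoulli (2*j) / fact (2*j))"
    using two_powers by (simp add: Z_def)
  finally have "lattice_sum (2 * j) =
      - ((-1) ^ j * pi ^ (2*j) * bernoulli (2*j) / fact (2*j) * t * (1 - 3 / 3 ^ (2*j)))"
    by (simp add: mult_ac)
  then show ?thesis
    by (simp only: t_def)
qed

lemma bernoulli_sum_split_first:
  "3 / fact (2*j) - (\<Sum>l=0..j. 6 ^ (2*l) * bernoulli (2*l) / (fact (2*j-2*l+1) * fact (2*l))) =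
    2 * ((3 * real j + 1) / fact (2*j+1)
      - 3 * (\<Sum>l=1..j. 6 ^ (2*l-1) * bernoulli (2*l) / (fact (2*j-2*l+1) * fact (2*l))))"
proof -
  let ?t = "\<lambda>l. 6 ^ (2*l) * bernoulli (2*l) / (fact (2*j-2*l+1) * fact (2*l))"
  let ?u = "\<lambda>l. 6 ^ (2*l-1) * bernoulli (2*l) / (fact (2*j-2*l+1) * fact (2*l))"
  have "(\<Sum>l=0..j. ?t l) = 1 / fact (2*j+1) + (\<Sum>l=1..j. ?t l)"
    by (simp add: sum.atLeast_Suc_atMost bernoulli_0)
  also have "(\<Sum>l=1..j. ?t l) = 6 * (\<Sum>l=1..j. ?u l)"
    unfolding sum_distrib_left
  proof (rule sum.cong)
    fix l assume "l \<in> {1..j}"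
    then have "(6::real) ^ (2 * l) = 6 * 6 ^ (2*l-1)"
      by (simp flip: power_Suc)
    then show "?t l = 6 * ?u l"
      by simp
  qed simp
  finally have "(\<Sum>l=0..j. ?t l) = 1 / fact (2*j+1) + 6 * (\<Sum>l=1..j. ?u l)" .
  moreover have "3 / fact (2*j) - 1 / fact (2*j+1) = 2 * ((3 * real j + 1) / fact (2*j+1))"
  proof -
    have "2 * real j + 1 \<noteq> 0"
      by linarith
    then have "3 / fact (2*j) = (2 * real j + 1) * 3 / ((2 * real j + 1) * fact (2*j))"
      by (rule mult_divide_mult_cancel_left[symmetric])
    also have "\<dots> = 3 * (2 * real j + 1) / fact (2*j+1)"
      by simp
    finally show ?thesis
      by (simp flip: diff_divide_distrib)
  qed
  ultimately show ?thesis
    by (simp only: right_diff_distrib diff_diff_add[symmetric])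
qed

lemma cot_fps_triple_mult_sin_nth_odd:
  "fps_nth (cot_fps (3 * of_real c) * fps_sin (of_real c)) (2 * j + 1) =
      of_real ((-1) ^ j * c ^ (2*j+1) *
    (\<Sum>l=0..j. 6 ^ (2*l) * bernoulli (2*l) / (fact (2*j-2*l+1) * fact (2*l))))"
proof -
  have "fps_nth (cot_fps (3 * of_real c) * fps_sin (of_real c)) (2 * j + 1) = of_real ((-1) ^ j *
      (\<Sum>l=0..j. (6 * c) ^ (2*l) * c ^ (2*j-2*l+1) * bernoulli (2*l) / (fact (2*j-2*l+1) * fact (2*l))))"
    unfolding cot_fps_mult_sin_nth_odd by simp
  also have "(\<Sum>l=0..j. (6 * c) ^ (2*l) * c ^ (2*j-2*l+1) * bernoulli (2*l)
        / (fact (2*j-2*l+1) * fact (2*l))) =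
      c ^ (2*j+1) * (\<Sum>l=0..j. 6 ^ (2*l) * bernoulli (2*l) / (fact (2*j-2*l+1) * fact (2*l)))"
    unfolding sum_distrib_left
  proof (rule sum.cong)
    fix l assume "l \<in> {0..j}"
    then have "c ^ (2*j+1) = c ^ (2*l) * c ^ (2*j-2*l+1)"
      by (simp flip: power_add)
    then have "(6 * c) ^ (2*l) * c ^ (2*j-2*l+1) = c ^ (2*j+1) * 6 ^ (2*l)"
      by (simp only: power_mult_distrib mult_ac)
    then show "(6 * c) ^ (2*l) * c ^ (2*j-2*l+1) * bernoulli (2*l) / (fact (2*j-2*l+1) * fact (2*l)) =
        c ^ (2*j+1) * (6 ^ (2*l) * bernoulli (2*l) / (fact (2*j-2*l+1) * fact (2*l)))"
      by (simp only: times_divide_eq_right mult.assoc)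
  qed simp
  finally show ?thesis
    by (simp only: mult.assoc)
qed

lemma lattice_sum_odd:
  "lattice_sum (2 * j + 1) =
    2 / sqrt 3 * ((pi/3) ^ (2*j+1) * (-1) ^ j * ((3 * real j + 1) / fact (2*j+1)
      - 3 * (\<Sum>l=1..j. 6 ^ (2*l-1) * bernoulli (2*l) / (fact (2*j-2*l+1) * fact (2*l)))))"
proof -
  define c where "c = pi / 3"
  let ?S = "\<Sum>l=0..j. 6 ^ (2*l) * bernoulli (2*l) / (fact (2*j-2*l+1) * fact (2*l))"
  have "complex_of_real (lattice_sum (2 * j + 1)) = fps_nth lattice_fps (2 * j + 1)"
    by (simp add: lattice_fps_def)
  also have "\<dots> = of_real (sqrt 3) / 3 *
      fps_nth (cosec_fps (3 * of_real c) * fps_sin (3 * of_real c - of_real c)) (2 * j + 1)"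
    by (simp add: lattice_fps_eq cosec_fps_nth_odd c_def)
  also have "\<dots> = of_real (sqrt 3 / 3 * (3 * c * ((-1) ^ j * c ^ (2*j) / fact (2*j))
      - (-1) ^ j * c ^ (2*j+1) * ?S))"
    unfolding cosec_fps_mult_sin_diff fps_sub_nth cot_fps_triple_mult_sin_nth_odd
    by (simp add: fps_cos_nth_even mult.assoc)
  finally have "lattice_sum (2 * j + 1) =
      sqrt 3 / 3 * (3 * c * ((-1) ^ j * c ^ (2*j) / fact (2*j)) - (-1) ^ j * c ^ (2*j+1) * ?S)"
    by (simp only: of_real_eq_iff)
  also have "\<dots> = sqrt 3 / 3 * (c ^ (2*j+1) * (-1) ^ j * (3 / fact (2*j) - ?S))"
    by (simp add: algebra_simps)
  also have "sqrt 3 / 3 = 1 / sqrt 3"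
    by (simp add: field_simps)
  finally show ?thesis
    unfolding bernoulli_sum_split_first by (simp add: c_def)
qed

lemma sum_split_parity:
  fixes f :: "nat \<Rightarrow> 'a::comm_monoid_add"
  assumes "k \<ge> 1"
  shows "(\<Sum>i=1..k. f i) = f 1 + (\<Sum>j=1..k div 2. f (2 * j)) + (\<Sum>j=1..(k-1) div 2. f (2 * j + 1))"
  using assms
proof (induction k rule: nat_induct_at_least)
  case (Suc k)
  show ?case
  proof (cases "even k")
    case True
    then have "Suc k div 2 = k div 2" "(Suc k - 1) div 2 = Suc ((k - 1) div 2)"
      "2 * Suc ((k - 1) div 2) + 1 = Suc k"
      using Suc.hyps by presburger+
    with Suc show ?thesis by (simp add: add.assoc)
  next
    case False
    then have "Suc k div 2 = Suc (k div 2)" "(Suc k - 1) div 2 = (k - 1) div 2"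
      "2 * Suc (k div 2) = Suc k"
      using Suc.hyps by presburger+
    with Suc show ?thesis by (simp add: ac_simps)
  qed
qed simp

lemma sum_choose_lattice_sum:
  assumes "k \<ge> 1"
  shows "(\<Sum>i=1..k. real (2*k - i - 1 choose (k - 1)) * lattice_sum i) =
     2 * pi / (3 * sqrt 3) * real ((2*k-2) choose (k-1))
     - (\<Sum>j=1..k div 2. (-1)^j * pi^(2*j) * bernoulli (2*j) / fact (2*j)
         * (2^(2*j-1) - 1) * (1 - 3 / 3^(2*j)) * real ((2*k-2*j-1) choose (k-1)))
     + 2 / sqrt 3 * (\<Sum>j=1..(k-1) div 2. (pi/3)^(2*j+1) * (-1)^j
         * real ((2*k-2*j-2) choose (k-1))
         * ((3*real j+1) / fact (2*j+1)
            - 3 * (\<Sum>l=1..j. 6^(2*l-1) * bernoulli (2*l) / (fact (2*j-2*l+1) * fact (2*l)))))"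
    (is "_ = ?first - ?even + ?odd")
proof -
  let ?b = "\<lambda>i. real (2*k - i - 1 choose (k - 1))"
  have "(\<Sum>i=1..k. ?b i * lattice_sum i) = ?b 1 * lattice_sum 1
      + (\<Sum>j=1..k div 2. ?b (2*j) * lattice_sum (2*j))
      + (\<Sum>j=1..(k-1) div 2. ?b (2*j+1) * lattice_sum (2*j+1))"
    by (rule sum_split_parity[OF assms])
  also have "?b 1 * lattice_sum 1 = ?first"
    using lattice_sum_odd[of 0] by (simp add: numeral_2_eq_2 mult_ac)
  also have "(\<Sum>j=1..k div 2. ?b (2*j) * lattice_sum (2*j)) = - ?even"
    unfolding sum_negf[symmetric] by (rule sum.cong) (auto simp: lattice_sum_even)
  also have "(\<Sum>j=1..(k-1) div 2. ?b (2*j+1) * lattice_sum (2*j+1)) = ?odd"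
    unfolding sum_distrib_left lattice_sum_odd
    by (rule sum.cong) (simp_all add: mult_ac)
  finally show ?thesis by simp
qed

lemma sum_choose_diagonal:
  assumes "k \<ge> 1"
  shows "(\<Sum>i=1..k. 2*k - i - 1 choose (k - 1)) = 2*k - 1 choose k"
proof -
  have "(\<Sum>i=1..k. 2*k - i - 1 choose (k - 1)) = (\<Sum>j\<le>k-1. k - 1 + j choose j)"
  proof (rule sum.reindex_bij_witness[of _ "\<lambda>j. k - j" "\<lambda>i. k - i"])
    fix i assume "i \<in> {1..k}"
    then have "2*k - i - 1 = k - 1 + (k - i)" by auto
    then show "k - 1 + (k - i) choose (k - i) = 2*k - i - 1 choose (k - 1)"
      by (simp add: binomial_symmetric[of "k - i"])
  qed (use assms in auto)
  also have "\<dots> = Suc (k - 1 + (k - 1)) choose (k - 1)"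
    by (rule sum_choose_lower)
  also have "Suc (k - 1 + (k - 1)) = 2*k - 1"
    using assms by simp
  also have "2*k - 1 choose (k - 1) = 2*k - 1 choose k"
    using assms binomial_symmetric[of k "2*k - 1"] by simp
  finally show ?thesis .
qed

lemma inverse_pentagonal_power_eq:
  assumes "m \<noteq> 0" "k \<ge> 1"
  shows "1 / real (pentagonal m) ^ k =
    (-6) ^ k * (\<Sum>i=1..k. real (2*k - i - 1 choose (k - 1)) * reflected_inverse_power (3 * of_int m) i)"
proof -
  define x where "x = 3 * real_of_int m"
  have "x \<noteq> 0" "x \<noteq> 1"
    using assms(1) by (auto simp: x_def)
  have "x * (1 - x) = - 6 * real (pentagonal m)"
    using arg_cong[OF two_pentagonal[of m], of real_of_int] by (simp add: x_def algebra_simps)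
  then have "1 / real (pentagonal m) ^ k = (-6) ^ k * (1 / (x * (1 - x)) ^ k)"
    by (simp only: power_mult_distrib) simp
  then show ?thesis
    unfolding x_def[symmetric]
    by (simp only: partial_fractions_mult_one_minus_power[OF \<open>x \<noteq> 0\<close> \<open>x \<noteq> 1\<close> assms(2)])
qed

text \<open>Division by zero makes the summand for \<open>m = 0\<close> vanish.\<close>
lemma pentagonal_power_esums:
  assumes "k \<ge> 1"
  shows "(\<lambda>m. (-1) powi m / real (pentagonal m) ^ k) esums
    ((-6) ^ k * ((\<Sum>i=1..k. real (2*k - i - 1 choose (k - 1)) * lattice_sum i)
        - real (2*k - 1 choose k)))"
proof -
  let ?b = "\<lambda>i. real (2*k - i - 1 choose (k - 1))"
  have "(\<lambda>m. (-6) ^ k * ((\<Sum>i=1..k. ?b i * lattice_term i m)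
      - (if m = 0 then real (2*k - 1 choose k) else 0))) esums
      ((-6) ^ k * ((\<Sum>i=1..k. ?b i * lattice_sum i) - real (2*k - 1 choose k)))"
    by (intro esums_mult esums_diff esums_sum esums_If_0 lattice_term_esums) auto
  moreover have "(-6) ^ k * ((\<Sum>i=1..k. ?b i * lattice_term i m)
      - (if m = 0 then real (2*k - 1 choose k) else 0)) =
      (-1) powi m / real (pentagonal m) ^ k" for m
  proof (cases "m = 0")
    case True
    have "(\<Sum>i=1..k. ?b i * lattice_term i 0) = (\<Sum>i=1..k. ?b i)"
      by (rule sum.cong) (auto simp: lattice_term_def reflected_inverse_power_def)
    also have "\<dots> = real (2*k - 1 choose k)"
      using sum_choose_diagonal[OF assms] by (simp flip: of_nat_sum)
    finally show ?thesis
      using True assms by simp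
  next
    case False
    then show ?thesis
      using arg_cong[OF inverse_pentagonal_power_eq[OF False assms], of "\<lambda>y. (-1) powi m * y"]
      by (simp add: lattice_term_def sum_distrib_left mult_ac)
  qed
  ultimately show ?thesis by simp
qed

subsection \<open>Integrals of exponential series\<close>

definition power_weight :: "nat \<Rightarrow> real \<Rightarrow> real" where
  "power_weight k x = indicator {0<..} x * (real k * x ^ (k - 1))"

lemma borel_measurable_power_weight [measurable]: "power_weight k \<in> borel_measurable borel"
  unfolding power_weight_def by measurable

lemma power_weight_nonneg: "0 \<le> power_weight k x"
  by (simp add: power_weight_def indicator_def)

lemma has_bochner_integral_power_weight_exp:
  assumes "a > 0" "k \<ge> 1"
  shows "has_bochner_integral lborel (\<lambda>x. power_weight k x * exp (- (a * x))) (fact k / a ^ k)"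
proof -
  obtain p where k: "k = Suc p"
    using assms(2) by (cases k) auto
  have "has_bochner_integral lborel (erlang_density p a) 1"
    using nn_integral_erlang_ith_moment[OF assms(1), of p 0] assms(1)
    by (intro has_bochner_integral_nn_integral) auto
  then have "has_bochner_integral lborel
      (\<lambda>x. fact k / a ^ k * erlang_density p a x) (fact k / a ^ k * 1)"
    by (rule has_bochner_integral_mult_right)
  also have "?this \<longleftrightarrow> has_bochner_integral lborel
      (\<lambda>x. power_weight k x * exp (- (a * x))) (fact k / a ^ k * 1)"
  proof (rule has_bochner_integral_cong_AE)
    have "AE x in lborel. x \<noteq> (0::real)" by (rule AE_lborel_singleton)
    then show "AE x in lborel. fact k / a ^ k * erlang_density p a x =
        power_weight k x * exp (- (a * x))"
      by eventually_elim
        (use assms(1) in \<open>auto simp: erlang_density_def power_weight_def k indicator_def\<close>)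
  qed measurable
  finally show ?thesis by simp
qed

lemma power_le_fact_mult_exp:
  fixes y :: real
  assumes "0 \<le> y"
  shows "y ^ k \<le> fact k * exp y"
proof -
  have exp: "(\<lambda>n. y ^ n / fact n) sums exp y"
    using exp_converges[of y] by (simp add: divide_inverse mult.commute)
  have "(\<Sum>n\<in>{k}. y ^ n / fact n) \<le> (\<Sum>n. y ^ n / fact n)"
    using assms sums_summable[OF exp] by (intro sum_le_suminf) auto
  then show ?thesis
    unfolding sums_unique[OF exp, symmetric] by (simp add: field_simps)
qed

lemma summable_abs_exp_series:
  fixes c a :: "nat \<Rightarrow> real"
  assumes "\<And>n. a n > 0" "summable (\<lambda>n. \<bar>c n / a n ^ k\<bar>)" "x > 0"
  shows "summable (\<lambda>n. \<bar>c n * exp (- (a n * x))\<bar>)"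
proof (rule summable_comparison_test')
  show "summable (\<lambda>n. fact k / x ^ k * \<bar>c n / a n ^ k\<bar>)"
    using assms(2) by (rule summable_mult)
  fix n
  have "(a n * x) ^ k \<le> fact k * exp (a n * x)"
    using assms(1)[of n] assms(3) by (intro power_le_fact_mult_exp) simp
  then have "exp (- (a n * x)) \<le> fact k / (a n * x) ^ k"
    using assms(1)[of n] assms(3) by (simp add: exp_minus field_simps)
  then have "\<bar>c n\<bar> * exp (- (a n * x)) \<le> \<bar>c n\<bar> * (fact k / (a n * x) ^ k)"
    by (rule mult_left_mono) simp
  then show "norm \<bar>c n * exp (- (a n * x))\<bar> \<le> fact k / x ^ k * \<bar>c n / a n ^ k\<bar>"
    using assms(1)[of n] by (simp add: power_mult_distrib abs_mult mult_ac)
qed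

lemma power_weight_exp_series:
  fixes c a :: "nat \<Rightarrow> real"
  assumes "\<And>n. a n > 0" "summable (\<lambda>n. \<bar>c n / a n ^ k\<bar>)"
  shows "summable (\<lambda>n. \<bar>power_weight k x * (c n * exp (- (a n * x)))\<bar>)"
    and "(\<Sum>n. power_weight k x * (c n * exp (- (a n * x)))) =
        power_weight k x * (\<Sum>n. c n * exp (- (a n * x)))"
proof -
  have "power_weight k x = 0 \<or> summable (\<lambda>n. \<bar>c n * exp (- (a n * x))\<bar>)"
    using summable_abs_exp_series[OF assms] by (cases "x > 0") (simp_all add: power_weight_def)
  then show "summable (\<lambda>n. \<bar>power_weight k x * (c n * exp (- (a n * x)))\<bar>)"
    and "(\<Sum>n. power_weight k x * (c n * exp (- (a n * x)))) =
        power_weight k x * (\<Sum>n. c n * exp (- (a n * x)))"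
    unfolding abs_mult[of "power_weight k x"]
    by (auto intro: summable_mult suminf_mult dest: summable_rabs_cancel)
qed

lemma has_bochner_integral_exp_series:
  fixes c a :: "nat \<Rightarrow> real"
  assumes pos: "\<And>n. a n > 0" and "k \<ge> 1" and summable: "summable (\<lambda>n. \<bar>c n / a n ^ k\<bar>)"
  shows "has_bochner_integral lborel (\<lambda>x. power_weight k x * (\<Sum>n. c n * exp (- (a n * x))))
    (fact k * (\<Sum>n. c n / a n ^ k))"
proof -
  define f where "f n x = power_weight k x * (c n * exp (- (a n * x)))" for n x
  note weight_exp = has_bochner_integral_power_weight_exp[OF pos \<open>k \<ge> 1\<close>]
  have integral: "has_bochner_integral lborel (f n) (c n * (fact k / a n ^ k))" for n
    using has_bochner_integral_mult_right[OF weight_exp, of "c n" n]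
    by (simp add: f_def[abs_def] mult.left_commute)
  have integral_norm: "has_bochner_integral lborel (\<lambda>x. norm (f n x)) (\<bar>c n\<bar> * (fact k / a n ^ k))" for n
    using has_bochner_integral_mult_right[OF weight_exp, of "\<bar>c n\<bar>" n]
    by (simp add: f_def abs_mult power_weight_nonneg mult.left_commute)
  have "integrable lborel (f n)" for n
    using integral by (auto simp: has_bochner_integral_iff)
  moreover have "summable (\<lambda>n. norm (f n x))" for x
    using power_weight_exp_series(1)[OF pos summable] by (simp add: f_def)
  moreover have "summable (\<lambda>n. \<integral>x. norm (f n x) \<partial>lborel)"
    unfolding has_bochner_integral_integral_eq[OF integral_norm]
    using summable_mult[OF summable, of "fact k"] pos by (simp add: less_imp_le mult.commute)
  ultimately have interchange: "integrable lborel (\<lambda>x. \<Sum>n. f n x)"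
      "(\<lambda>n. \<integral>x. f n x \<partial>lborel) sums (\<integral>x. (\<Sum>n. f n x) \<partial>lborel)"
    by (auto intro!: integrable_suminf sums_integral)
  have "(\<lambda>n. fact k * (c n / a n ^ k)) sums (\<integral>x. (\<Sum>n. f n x) \<partial>lborel)"
    using interchange(2) by (simp add: has_bochner_integral_integral_eq[OF integral] mult.commute)
  then have "(\<integral>x. (\<Sum>n. f n x) \<partial>lborel) = fact k * (\<Sum>n. c n / a n ^ k)"
    using suminf_mult[OF summable_rabs_cancel[OF summable], of "fact k"] by (simp only: sums_iff)
  then show ?thesis
    using interchange(1) power_weight_exp_series(2)[OF pos summable]
    by (simp add: has_bochner_integral_iff f_def)
qed

lemma summable_inverse_pentagonal_power:
  assumes "k \<ge> 1"
  shows "summable (\<lambda>n. 1 / real (pentagonal (int (Suc n))) ^ k)"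
    and "summable (\<lambda>n. 1 / real (pentagonal (- int (Suc n))) ^ k)"
proof -
  have bound: "1 / real (pentagonal m) ^ k \<le> 1 / real_of_int m ^ 2" if "m \<noteq> 0" for m
  proof -
    have "real (pentagonal m) \<le> real (pentagonal m) ^ k"
      using assms pentagonal_pos[OF that] by (intro self_le_power) auto
    then have "real_of_int m ^ 2 \<le> real (pentagonal m) ^ k"
      using pentagonal_ge_square[of m] by (rule order_trans[rotated])
    then show ?thesis
      using that by (intro frac_le) auto
  qed
  have "norm (1 / real (pentagonal (int (Suc n))) ^ k) \<le> 1 / real_of_int (int (Suc n)) ^ 2"
    "norm (1 / real (pentagonal (- int (Suc n))) ^ k) \<le> 1 / real_of_int (int (Suc n)) ^ 2" for n
    using bound[of "int (Suc n)"] bound[of "- int (Suc n)"]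
    by (simp_all only: of_int_minus power2_minus) simp_all
  then show "summable (\<lambda>n. 1 / real (pentagonal (int (Suc n))) ^ k)"
    "summable (\<lambda>n. 1 / real (pentagonal (- int (Suc n))) ^ k)"
    by (auto intro: summable_comparison_test'[OF summable_inverse_square_Suc])
qed

lemma has_bochner_integral_one_minus_euler_function:
  assumes "k \<ge> 1" and esums: "(\<lambda>m. (-1) powi m / real (pentagonal m) ^ k) esums s"
  shows "has_bochner_integral lborel
    (\<lambda>x. power_weight k x * (1 - euler_function (exp (- x)))) (fact k * - s)"
proof -
  define a where "a n = real (pentagonal (int (Suc n)))" for n
  define b where "b n = real (pentagonal (- int (Suc n)))" for n
  have pos: "a n > 0" "b n > 0" for n
    using pentagonal_pos[of "int (Suc n)"] pentagonal_pos[of "- int (Suc n)"]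
    by (simp_all add: a_def b_def)
  have summable: "summable (\<lambda>n. \<bar>(-1) ^ Suc n / a n ^ k\<bar>)" "summable (\<lambda>n. \<bar>(-1) ^ Suc n / b n ^ k\<bar>)"
    using summable_inverse_pentagonal_power[OF assms(1)] by (simp_all add: a_def b_def)
  have series: "(\<Sum>n. (-1) ^ Suc n * exp (- (a n * x))) + (\<Sum>n. (-1) ^ Suc n * exp (- (b n * x)))
      = euler_function (exp (- x)) - 1" if "x > 0" for x
  proof -
    have "(\<lambda>m. (-1) powi m * exp (- (real (pentagonal m) * x))) esums euler_function (exp (- x))"
      using pentagonal_number_theorem[of "exp (- x)"] that by (simp flip: exp_of_nat_mult)
    from esums_imp_suminf_add_suminf[OF this] show ?thesis
      using summable_abs_exp_series[OF pos(1) summable(1) that, THEN summable_rabs_cancel]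
        summable_abs_exp_series[OF pos(2) summable(2) that, THEN summable_rabs_cancel]
      by (simp add: a_def b_def power_int_minus_one_Suc del: of_nat_Suc power_Suc)
  qed
  have "(\<Sum>n. (-1) ^ Suc n / a n ^ k) + (\<Sum>n. (-1) ^ Suc n / b n ^ k) = s"
    using esums_imp_suminf_add_suminf[OF esums] summable[THEN summable_rabs_cancel] assms(1)
    by (simp add: a_def b_def power_int_minus_one_Suc power_0_left del: of_nat_Suc power_Suc)
  with has_bochner_integral_add[OF has_bochner_integral_exp_series[OF pos(1) assms(1) summable(1)]
      has_bochner_integral_exp_series[OF pos(2) assms(1) summable(2)]]
  have "has_bochner_integral lborel (\<lambda>x. power_weight k x * (\<Sum>n. (-1) ^ Suc n * exp (- (a n * x)))
      + power_weight k x * (\<Sum>n. (-1) ^ Suc n * exp (- (b n * x)))) (fact k * s)"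
    by (simp del: power_Suc flip: distrib_left)
  also have "(\<lambda>x. power_weight k x * (\<Sum>n. (-1) ^ Suc n * exp (- (a n * x)))
      + power_weight k x * (\<Sum>n. (-1) ^ Suc n * exp (- (b n * x)))) =
      (\<lambda>x. power_weight k x * (euler_function (exp (- x)) - 1))"
  proof
    fix x :: real
    show "power_weight k x * (\<Sum>n. (-1) ^ Suc n * exp (- (a n * x)))
      + power_weight k x * (\<Sum>n. (-1) ^ Suc n * exp (- (b n * x))) =
      power_weight k x * (euler_function (exp (- x)) - 1)"
      by (cases "x > 0") (simp_all only: series power_weight_def distrib_left[symmetric], simp)
  qed
  finally have "has_bochner_integral lborel
      (\<lambda>x. power_weight k x * (euler_function (exp (- x)) - 1)) (fact k * s)" .
  from has_bochner_integral_minus[OF this] show ?thesis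
    by (simp add: right_diff_distrib)
qed

subsection \<open>The distribution of the maximum\<close>

text \<open>
  The supremum has a junk value on the set where the family is unbounded; as this value is constant,
  the supremum is measurable even if that set is not empty.
\<close>
lemma Sup_real_unbounded:
  fixes S :: "real set"
  assumes "\<not> bdd_above S"
  shows "Sup S = (LEAST z. False)"
  using assms unfolding Sup_real_def bdd_above_def by metis

lemma borel_measurable_SUP_real:
  fixes Y :: "'i \<Rightarrow> 'a \<Rightarrow> real"
  assumes "countable I" and [measurable]: "\<And>i. i \<in> I \<Longrightarrow> Y i \<in> borel_measurable M"
  shows "(\<lambda>\<omega>. SUP i\<in>I. Y i \<omega>) \<in> borel_measurable M"
proof -
  define B where "B = {\<omega> \<in> space M. \<exists>n::nat. \<forall>i\<in>I. Y i \<omega> \<le> real n}"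
  have [measurable]: "B \<in> sets M"
    unfolding B_def using \<open>countable I\<close> by measurable
  have bdd: "bdd_above ((\<lambda>i. Y i \<omega>) ` I) \<longleftrightarrow> \<omega> \<in> B" if "\<omega> \<in> space M" for \<omega>
    using that by (auto simp: B_def bdd_above_def) (meson order_trans real_arch_simple)
  have "(\<lambda>\<omega>. SUP i\<in>I. if \<omega> \<in> B then Y i \<omega> else 0) \<in> borel_measurable M"
  proof (rule borel_measurable_cSUP[OF \<open>countable I\<close>])
    show "(\<lambda>\<omega>. if \<omega> \<in> B then Y i \<omega> else 0) \<in> borel_measurable M" if "i \<in> I" for i
      using that by measurable
    show "bdd_above ((\<lambda>i. if \<omega> \<in> B then Y i \<omega> else 0) ` I)" if "\<omega> \<in> space M" for \<omega>
      using bdd[OF that] by (cases "\<omega> \<in> B") auto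
  qed
  then have "(\<lambda>\<omega>. if \<omega> \<in> B then SUP i\<in>I. if \<omega> \<in> B then Y i \<omega> else 0 else (LEAST z. False))
      \<in> borel_measurable M"
    by measurable
  then show ?thesis
  proof (rule measurable_cong[THEN iffD1, rotated])
    fix \<omega> assume "\<omega> \<in> space M"
    then show "(if \<omega> \<in> B then SUP i\<in>I. if \<omega> \<in> B then Y i \<omega> else 0 else (LEAST z. False)) =
        (SUP i\<in>I. Y i \<omega>)"
      using bdd[of \<omega>] Sup_real_unbounded[of "(\<lambda>i. Y i \<omega>) ` I"] by auto
  qed
qed

lemma nn_integral_power_weight_lessThan:
  assumes "0 \<le> z" "k \<ge> 1"
  shows "(\<integral>\<^sup>+x. ennreal (power_weight k x) * indicator {..<z} x \<partial>lborel) = ennreal (z ^ k)"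
proof -
  have "(\<integral>\<^sup>+x. ennreal (power_weight k x) * indicator {..<z} x \<partial>lborel) =
      (\<integral>\<^sup>+x. ennreal (real k * x ^ (k - 1)) * indicator {0..z} x \<partial>lborel)"
  proof (rule nn_integral_cong_AE)
    have "AE x in lborel. x \<noteq> (0::real)" "AE x in lborel. x \<noteq> z" by (rule AE_lborel_singleton)+
    then show "AE x in lborel. ennreal (power_weight k x) * indicator {..<z} x
        = ennreal (real k * x ^ (k - 1)) * indicator {0..z} x"
      by eventually_elim (auto simp: power_weight_def indicator_def)
  qed
  also have "\<dots> = ennreal (z ^ k - 0 ^ k)"
    using assms(1) by (intro nn_integral_FTC_Icc) (auto intro!: derivative_eq_intros)
  finally show ?thesis
    using assms(2) by (simp add: power_0_left)
qed

lemma (in sigma_finite_measure) nn_integral_power_eq_tail: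
  fixes Z :: "'a \<Rightarrow> real"
  assumes [measurable]: "Z \<in> borel_measurable M" and nonneg: "AE \<omega> in M. 0 \<le> Z \<omega>" and "k \<ge> 1"
  shows "(\<integral>\<^sup>+\<omega>. ennreal (Z \<omega> ^ k) \<partial>M) =
    (\<integral>\<^sup>+x. ennreal (power_weight k x) * emeasure M {\<omega> \<in> space M. x < Z \<omega>} \<partial>lborel)"
proof -
  interpret pair_sigma_finite M "lborel :: real measure" ..
  have "(\<integral>\<^sup>+\<omega>. ennreal (Z \<omega> ^ k) \<partial>M) =
      (\<integral>\<^sup>+\<omega>. (\<integral>\<^sup>+x. ennreal (power_weight k x) * indicator {..<Z \<omega>} x \<partial>lborel) \<partial>M)"
    using nonneg
    by (intro nn_integral_cong_AE) (auto simp: nn_integral_power_weight_lessThan[OF _ \<open>k \<ge> 1\<close>])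
  also have "\<dots> =
      (\<integral>\<^sup>+\<omega>. (\<integral>\<^sup>+x. ennreal (power_weight k x) * indicator {\<omega> \<in> space M. x < Z \<omega>} \<omega> \<partial>lborel) \<partial>M)"
    by (intro nn_integral_cong) (auto simp: indicator_def)
  also have "\<dots> =
      (\<integral>\<^sup>+x. (\<integral>\<^sup>+\<omega>. ennreal (power_weight k x) * indicator {\<omega> \<in> space M. x < Z \<omega>} \<omega> \<partial>M) \<partial>lborel)"
    by (intro Fubini'[symmetric]) measurable
  also have "\<dots> = (\<integral>\<^sup>+x. ennreal (power_weight k x) * emeasure M {\<omega> \<in> space M. x < Z \<omega>} \<partial>lborel)"
    by (intro nn_integral_cong nn_integral_cmult_indicator) measurable
  finally show ?thesis .
qed

lemma (in prob_space) has_bochner_integral_power_of_tail: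
  fixes Z :: "'a \<Rightarrow> real"
  assumes [measurable]: "Z \<in> borel_measurable M" and nonneg: "AE \<omega> in M. 0 \<le> Z \<omega>" and "k \<ge> 1"
    and tail: "has_bochner_integral lborel (\<lambda>x. power_weight k x * prob {\<omega> \<in> space M. x < Z \<omega>}) v"
  shows "has_bochner_integral M (\<lambda>\<omega>. Z \<omega> ^ k) v"
proof (rule has_bochner_integral_nn_integral)
  have tail_nonneg: "0 \<le> power_weight k x * prob {\<omega> \<in> space M. x < Z \<omega>}" for x
    by (simp add: power_weight_nonneg)
  have "(\<integral>\<^sup>+\<omega>. ennreal (Z \<omega> ^ k) \<partial>M) =
      (\<integral>\<^sup>+x. ennreal (power_weight k x * prob {\<omega> \<in> space M. x < Z \<omega>}) \<partial>lborel)"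
    by (simp add: nn_integral_power_eq_tail[OF assms(1-3)]
        emeasure_eq_measure ennreal_mult power_weight_nonneg)
  also have "\<dots> = ennreal v"
    using tail tail_nonneg by (simp add: has_bochner_integral_iff nn_integral_eq_integral)
  finally show "(\<integral>\<^sup>+\<omega>. ennreal (Z \<omega> ^ k) \<partial>M) = ennreal v" .
  show "0 \<le> v"
    unfolding has_bochner_integral_integral_eq[OF tail, symmetric]
    by (intro Bochner_Integration.integral_nonneg tail_nonneg)
qed (use nonneg in auto)

lemma (in prob_space) prod_prob_le_LIMSEQ:
  fixes X :: "nat \<Rightarrow> 'a \<Rightarrow> real"
  assumes "indep_vars (\<lambda>_. borel) X {m..}"
  shows "(\<lambda>n. \<Prod>i=m..m+n. prob {\<omega> \<in> space M. X i \<omega> \<le> x}) \<longlonglongrightarrow> prob {\<omega> \<in> space M. \<forall>i\<ge>m. X i \<omega> \<le> x}"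
proof -
  have [measurable]: "X i \<in> borel_measurable M" if "i \<in> {m..}" for i
    using assms that by (auto simp: indep_vars_def)
  define A where "A n = {\<omega> \<in> space M. \<forall>i\<in>{m..m+n}. X i \<omega> \<le> x}" for n
  have "prob (A n) = (\<Prod>i=m..m+n. prob {\<omega> \<in> space M. X i \<omega> \<le> x})" for n
  proof -
    have "A n = (\<Inter>i\<in>{m..m+n}. X i -` {..x} \<inter> space M)"
      by (auto simp: A_def)
    also have "prob \<dots> = (\<Prod>i=m..m+n. prob (X i -` {..x} \<inter> space M))"
      by (intro indep_varsD[OF assms]) auto
    finally show ?thesis
      by (simp add: vimage_def Int_def conj_commute)
  qed
  moreover have "(\<lambda>n. prob (A n)) \<longlonglongrightarrow> prob (\<Inter>n. A n)"
    by (rule finite_Lim_measure_decseq) (auto simp: A_def decseq_def)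
  moreover have "(\<Inter>n. A n) = {\<omega> \<in> space M. \<forall>i\<ge>m. X i \<omega> \<le> x}"
    by (auto simp: A_def) (metis atLeastAtMost_iff le_add_diff_inverse order_refl)
  ultimately show ?thesis by simp
qed

lemma (in prob_space) AE_bdd_above_of_summable_tail:
  fixes X :: "nat \<Rightarrow> 'a \<Rightarrow> real"
  assumes [measurable]: "\<And>i. i \<ge> m \<Longrightarrow> X i \<in> borel_measurable M"
    and "summable (\<lambda>i. prob {\<omega> \<in> space M. c < X (m + i) \<omega>})"
  shows "AE \<omega> in M. bdd_above ((\<lambda>i. X i \<omega>) ` {m..})"
proof -
  have "AE \<omega> in M. eventually (\<lambda>i. \<omega> \<in> space M - {\<omega> \<in> space M. c < X (m + i) \<omega>}) sequentially"
    using assms(2) by (intro borel_cantelli_AE1) (auto simp: emeasure_eq_measure)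
  then show ?thesis
  proof eventually_elim
    fix \<omega> assume "eventually (\<lambda>i. \<omega> \<in> space M - {\<omega> \<in> space M. c < X (m + i) \<omega>}) sequentially"
    then obtain N where N: "\<And>i. i \<ge> N \<Longrightarrow> X (m + i) \<omega> \<le> c"
      by (auto simp: eventually_sequentially not_less)
    have "X i \<omega> \<in> (\<lambda>i. X i \<omega>) ` {m..<m+N} \<union> {..c}" if "i \<ge> m" for i
      using that N[of "i - m"] by (cases "i < m + N") auto
    then have "(\<lambda>i. X i \<omega>) ` {m..} \<subseteq> (\<lambda>i. X i \<omega>) ` {m..<m+N} \<union> {..c}"
      by auto
    then show "bdd_above ((\<lambda>i. X i \<omega>) ` {m..})"
      by (rule bdd_above_mono[rotated]) auto
  qed
qed

lemma (in prob_space) prob_SUP_gt: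
  fixes X :: "'i \<Rightarrow> 'a \<Rightarrow> real"
  assumes "countable I" "I \<noteq> {}" and [measurable]: "\<And>i. i \<in> I \<Longrightarrow> X i \<in> borel_measurable M"
    and "AE \<omega> in M. bdd_above ((\<lambda>i. X i \<omega>) ` I)"
  shows "prob {\<omega> \<in> space M. x < (SUP i\<in>I. X i \<omega>)} = 1 - prob {\<omega> \<in> space M. \<forall>i\<in>I. X i \<omega> \<le> x}"
proof -
  note borel_measurable_SUP_real[OF assms(1,3), measurable]
  have [measurable]: "{\<omega> \<in> space M. \<forall>i\<in>I. X i \<omega> \<le> x} \<in> events"
    using \<open>countable I\<close> by measurable
  have "prob {\<omega> \<in> space M. x < (SUP i\<in>I. X i \<omega>)} = prob (space M - {\<omega> \<in> space M. \<forall>i\<in>I. X i \<omega> \<le> x})"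
  proof (rule finite_measure_eq_AE)
    show "AE \<omega> in M. (\<omega> \<in> {\<omega> \<in> space M. x < (SUP i\<in>I. X i \<omega>)})
        = (\<omega> \<in> space M - {\<omega> \<in> space M. \<forall>i\<in>I. X i \<omega> \<le> x})"
      using assms(4) by eventually_elim (auto simp: less_cSUP_iff[OF \<open>I \<noteq> {}\<close>] not_le)
  qed measurable
  also have "\<dots> = 1 - prob {\<omega> \<in> space M. \<forall>i\<in>I. X i \<omega> \<le> x}"
    by (rule prob_compl) measurable
  finally show ?thesis .
qed

context prob_space
begin

context
  fixes X :: "nat \<Rightarrow> 'a \<Rightarrow> real"
  assumes distr: "\<And>i. i \<ge> 1 \<Longrightarrow> distributed M lborel (X i) (exponential_density (real i))"
begin

lemma exponential_measurable: "i \<ge> 1 \<Longrightarrow> X i \<in> borel_measurable M"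
  using distributed_measurable[OF distr[of i]] by simp

lemma borel_measurable_SUP_exponential: "(\<lambda>\<omega>. SUP i\<in>{1..}. X i \<omega>) \<in> borel_measurable M"
  by (intro borel_measurable_SUP_real exponential_measurable) auto

lemma AE_exponential_bdd_above: "AE \<omega> in M. bdd_above ((\<lambda>i. X i \<omega>) ` {1..})"
proof (rule AE_bdd_above_of_summable_tail[OF exponential_measurable])
  have "prob {\<omega> \<in> space M. 1 < X (1 + i) \<omega>} = exp (-1) ^ Suc i" for i
    using exponential_distributedD_gt[OF distr[of "1 + i"], of 1]
    by (simp add: algebra_simps flip: exp_of_nat_mult exp_add)
  then show "summable (\<lambda>i. prob {\<omega> \<in> space M. 1 < X (1 + i) \<omega>})"
    by (simp add: summable_mult summable_geometric)
qed

lemma AE_SUP_exponential_nonneg: "AE \<omega> in M. 0 \<le> (SUP i\<in>{1..}. X i \<omega>)"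
proof -
  note exponential_measurable[of "Suc 0", simplified, measurable]
  have "\<P>(\<omega> in M. 0 < X 1 \<omega>) = 1"
    using exponential_distributedD_gt[OF distr[of 1], of 0] by simp
  then have "AE \<omega> in M. 0 < X 1 \<omega>"
    by (subst (asm) prob_Collect_eq_1) auto
  with AE_exponential_bdd_above show ?thesis
    by eventually_elim (rule cSUP_upper2, auto)
qed

context
  assumes indep: "indep_vars (\<lambda>_. borel) X {1..}"
begin

lemma prob_SUP_exponential_gt:
  assumes "x > 0"
  shows "prob {\<omega> \<in> space M. x < (SUP i\<in>{1..}. X i \<omega>)} = 1 - euler_function (exp (- x))"
proof -
  have "prob {\<omega> \<in> space M. X i \<omega> \<le> x} = 1 - exp (- x) ^ i" if "i \<ge> 1" for i
    using exponential_distributedD_le[OF distr[OF that], of x] assms that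
    by (simp add: mult.commute flip: exp_of_nat_mult)
  then have "(\<lambda>n. \<Prod>i=1..1+n. 1 - exp (- x) ^ i) \<longlonglongrightarrow> prob {\<omega> \<in> space M. \<forall>i\<ge>1. X i \<omega> \<le> x}"
    using prod_prob_le_LIMSEQ[OF indep, of x] by simp
  moreover have "(\<lambda>n. \<Prod>i=1..1+n. 1 - exp (- x) ^ i) \<longlonglongrightarrow> euler_function (exp (- x))"
    using LIMSEQ_Suc[OF euler_function_LIMSEQ[of "exp (- x)"]] assms by simp
  ultimately have "prob {\<omega> \<in> space M. \<forall>i\<ge>1. X i \<omega> \<le> x} = euler_function (exp (- x))"
    by (rule LIMSEQ_unique)
  moreover have "prob {\<omega> \<in> space M. x < (SUP i\<in>{1..}. X i \<omega>)} =
      1 - prob {\<omega> \<in> space M. \<forall>i\<in>{1..}. X i \<omega> \<le> x}"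
    by (intro prob_SUP_gt exponential_measurable AE_exponential_bdd_above) auto
  ultimately show ?thesis
    by (simp add: Ball_def)
qed

lemma has_bochner_integral_SUP_exponential_power:
  assumes "k \<ge> 1" and "(\<lambda>m. (-1) powi m / real (pentagonal m) ^ k) esums s"
  shows "has_bochner_integral M (\<lambda>\<omega>. (SUP i\<in>{1..}. X i \<omega>) ^ k) (fact k * - s)"
proof (rule has_bochner_integral_power_of_tail)
  have "(\<lambda>x. power_weight k x * prob {\<omega> \<in> space M. x < (SUP i\<in>{1..}. X i \<omega>)}) =
      (\<lambda>x. power_weight k x * (1 - euler_function (exp (- x))))"
    using prob_SUP_exponential_gt by (auto simp: fun_eq_iff power_weight_def indicator_def)
  then show "has_bochner_integral lborel
      (\<lambda>x. power_weight k x * prob {\<omega> \<in> space M. x < (SUP i\<in>{1..}. X i \<omega>)}) (fact k * - s)"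
    using has_bochner_integral_one_minus_euler_function[OF assms] by simp
qed (rule borel_measurable_SUP_exponential AE_SUP_exponential_nonneg assms(1))+

end

end

end

theorem theorem4:
  fixes P :: "'a measure" and X :: "nat \<Rightarrow> 'a \<Rightarrow> real" and k :: nat
  assumes "prob_space P"
    and "prob_space.indep_vars P (\<lambda>_. borel) X {1..}"
    and "\<And>i. i \<ge> 1 \<Longrightarrow> distributed P lborel (X i) (exponential_density (real i))"
    and "k \<ge> 1"
  shows "integrable P (\<lambda>\<omega>. (SUP i\<in>{1..}. X i \<omega>) ^ k)
    \<and> prob_space.expectation P (\<lambda>\<omega>. (SUP i\<in>{1..}. X i \<omega>) ^ k) =
      fact k * (-6) ^ k *
        ( real ((2*k-1) choose k)
          - 2 * pi / (3 * sqrt 3) * real ((2*k-2) choose (k-1))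
          + (\<Sum>j=1..k div 2. (-1)^j * pi^(2*j) * bernoulli (2*j) / fact (2*j)
                * (2^(2*j-1) - 1) * (1 - 3 / 3^(2*j)) * real ((2*k-2*j-1) choose (k-1)))
          - 2 / sqrt 3 * (\<Sum>j=1..(k-1) div 2. (pi/3)^(2*j+1) * (-1)^j
                * real ((2*k-2*j-2) choose (k-1))
                * ((3*real j+1) / fact (2*j+1)
                   - 3 * (\<Sum>l=1..j. 6^(2*l-1) * bernoulli (2*l)
                          / (fact (2*j-2*l+1) * fact (2*l))))))"
proof -
  interpret prob_space P by fact
  have regroup: "fact k * - (c * (first - evens + odds - b)) = fact k * c * (b - first + evens - odds)"
    for c first evens odds b :: real
    by (simp add: algebra_simps)
  have "has_bochner_integral P (\<lambda>\<omega>. (SUP i\<in>{1..}. X i \<omega>) ^ k) (fact k * - ((-6) ^ k *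
      ((\<Sum>i=1..k. real (2*k - i - 1 choose (k - 1)) * lattice_sum i) - real (2*k - 1 choose k))))"
    using assms(2-4) by (intro has_bochner_integral_SUP_exponential_power pentagonal_power_esums)
  then show ?thesis
    unfolding sum_choose_lattice_sum[OF assms(4)] regroup by (simp only: has_bochner_integral_iff)
qed

end
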